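(* Let $X=(X_t)_{t\ge 0}$ be a Feller evolution process on $\mathbb{R}^d$ with Feller evolution system $(T_{s,t})_{0\le s\le t<\infty}$ and generators $(\mathcal{A}_s)_{s\ge 0}$ with rich domains, and suppose that $C_c^\infty(\mathbb{R}^d)$ is a core for $\mathcal{A}_s$ for all $s\ge 0$. Let the corresponding symbols $p_s(x,\xi)$ be $s$-continuous and bounded, with characteristic triplet $(b_s(x),0,\nu_s(x,dy))$. If $X$ is spatially PUOD, then $$\nu_s\big(x,(\mathbb{R}_+^d\cup\mathbb{R}_-^d)^c\big)=0,\qquad\forall s\ge0,\ \forall x\in\mathbb{R}^d.$$
   Context: Notation: $\mathbb{R}_+=[0,\infty)$, $\mathbb{R}_+^d=[0,\infty)^d$, $\mathbb{R}_-^d=(-\infty,0]^d$. $B_b(\mathbb{R}^d)$ is the space of bounded Borel functions $\mathbb{R}^d\to\mathbb{R}$; $C_0(\mathbb{R}^d)$ the continuous functions vanishing at infinity, with sup-norm $\|\cdot\|_\infty$; $C_c^\infty(\mathbb{R}^d)$ the smooth compactly supported functions. Feller evolution process (FEP): for a (time-inhomogeneous) Markov process $X=(X_t)_{t\ge0}$ on $\mathbb{R}^d$, its Markov evolution is $T_{s,t}f(x)=\mathbb{E}[f(X_t)\mid X_s=x]$, $0\le s\le t<\infty$, $f\in B_b(\mathbb{R}^d)$, with $T_{s,t}:B_b(\mathbb{R}^d)\to B_b(\mathbb{R}^d)$, $T_{s,s}=I$, $T_{s,t}1=1$. It is a Feller evolution system (FES), and $X$ is an FEP, if on $C_0(\mathbb{R}^d)$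 the operators $T_{s,t}:C_0(\mathbb{R}^d)\to C_0(\mathbb{R}^d)$ are positivity-preserving contractions, satisfy $T_{r,s}T_{s,t}=T_{r,t}$ for $r\le s\le t$, and are strongly continuous: $\lim_{(u,v)\to(s,t)}\|T_{u,v}f-T_{s,t}f\|_\infty=0$ for all $f\in C_0(\mathbb{R}^d)$ and $s\le t$. Generators: $\mathcal{A}_s^+f=\lim_{h\searrow0}(T_{s,s+h}f-f)/h$ ($s\ge0$) and $\mathcal{A}_s^-f=\lim_{h\searrow0}(T_{s-h,s}f-f)/h$ ($s>0$), with domains $\mathcal{D}(\mathcal{A}_s^\pm)$ the sets of $f\in C_0(\mathbb{R}^d)$ for which the limit exists in $\|\cdot\|_\infty$. The domains are rich if $C_c^\infty(\mathbb{R}^d)\subset\mathcal{D}(\mathcal{A}_s^\pm)$ for all $s$. Then on $C_c^\infty(\mathbb{R}^d)$, $\mathcal{A}_s^\pm f(x)=(2\pi)^{-d/2}\int_{\mathbb{R}^d}e^{ix\cdot\xi}p_s^\pm(x,\xi)\hat f(\xi)\,d\xi$, where $\hat f(\xi)=(2\pi)^{-d/2}\int e^{-ix\cdot\xi}f(x)\,dx$; $p_s^\pm(x,\xi)$ are the symbols. The symbols are $s$-continuous if $s\mapsto p_s^\pm(x,\xi)$ is continuous for all $x,\xi$, and bounded if there is $C>0$ with $|p_s^\pm(x,\xi)|\le C(1+|\xi|^2)$ for all $s,x,\xi$. Under these two conditions the left and right generators coincide (a theorem of Böttcher); write $\mathcal{A}_s$ and $p_s$ for the common generator and symbol. A core for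 $\mathcal{A}_s$ is a subspace of $\mathcal{D}(\mathcal{A}_s)$ dense in it for the graph norm. Characteristic triplet: the symbol has the form $$p_s(x,\xi)=ib_s(x)\cdot\xi-\tfrac12\xi\cdot\Sigma_s(x)\xi+\int_{y\ne0}\big(e^{i\xi\cdot y}-1-i\xi\cdot y\,\chi(y)\big)\nu_s(x,dy),\qquad \chi(y)=\mathbf{1}_{(0,1)}(|y|),$$ with $b_s(x)\in\mathbb{R}^d$, $\Sigma_s(x)$ symmetric nonnegative definite, $\nu_s(x,\cdot)$ a Lévy measure; $(b_s(x),\Sigma_s(x),\nu_s(x,dy))$ is the characteristic triplet. Triplet $(b_s(x),0,\nu_s(x,dy))$ means $\Sigma_s\equiv0$ for all $s$. Spatially PUOD (positive upper orthant dependent): for every $s\le t$, $x\in\mathbb{R}^d$, and all non-decreasing $f_1,\dots,f_d:\mathbb{R}\to\mathbb{R}_+$, $$\mathbb{E}\Big[\prod_{i=1}^d f_i(X_t^{(i)})\,\Big|\,X_s=x\Big]\ \ge\ \prod_{i=1}^d\mathbb{E}\big[f_i(X_t^{(i)})\,\big|\,X_s=x\big],$$ where $X_t=(X_t^{(1)},\dots,X_t^{(d)})$. *)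

theory Defs
  imports "HOL-Probability.Probability"
begin

definition sup_norm :: "('a \<Rightarrow> real) \<Rightarrow> real"
  where "sup_norm f = (SUP x. \<bar>f x\<bar>)"

definition bounded_borel :: "('a::topological_space \<Rightarrow> real) set"
  where "bounded_borel = {f. f \<in> borel_measurable borel \<and> bounded (range f)}"

definition C0 :: "('a::real_normed_vector \<Rightarrow> real) set"
  where "C0 = {f. continuous_on UNIV f \<and> (f \<longlongrightarrow> 0) at_infinity}"

text \<open>
  \<open>C_times k f\<close>: \<open>f\<close> is of class \<open>C\<^sup>k\<close>, that is, all its iterated directional derivatives up to
  order \<open>k\<close> exist and are continuous. (From stage to stage the function is required to be
  Frechet differentiable, so that \<open>frechet_derivative\<close> is meaningful.)
\<close>

primrec C_times :: "nat \<Rightarrow> ('a::euclidean_space \<Rightarrow> real) \<Rightarrow> bool" where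
  "C_times 0 f \<longleftrightarrow> continuous_on UNIV f"
| "C_times (Suc k) f \<longleftrightarrow>
     (\<forall>x. f differentiable (at x)) \<and> (\<forall>v. C_times k (\<lambda>x. frechet_derivative f (at x) v))"

definition Cc_infty :: "('a::euclidean_space \<Rightarrow> real) set"
  where "Cc_infty = {f. (\<forall>k. C_times k f) \<and> compact (closure {x. f x \<noteq> 0})}"

definition past :: "'w measure \<Rightarrow> (real \<Rightarrow> 'w \<Rightarrow> 'a::topological_space) \<Rightarrow> real \<Rightarrow> real \<Rightarrow> 'w measure"
  where "past M X s t =
    sigma (space M) (\<Union>r\<in>{s..t}. {X r -` B \<inter> space M |B. B \<in> sets borel})"

text \<open>
  The law \<open>P s x\<close> is the distribution on the sample space \<open>M\<close> of the process started at time \<open>s\<close>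
  in the point \<open>x\<close>; the conditional expectation given \<open>X s = x\<close> is the expectation under
  \<open>P s x\<close>. This makes it meaningful for every point \<open>x\<close>, not only for almost every \<open>x\<close>.
\<close>

definition markov_evolution ::
    "(real \<Rightarrow> 'a \<Rightarrow> 'w measure) \<Rightarrow> (real \<Rightarrow> 'w \<Rightarrow> 'a) \<Rightarrow> real \<Rightarrow> real \<Rightarrow> ('a \<Rightarrow> real) \<Rightarrow> 'a \<Rightarrow> real"
  where "markov_evolution P X s t f x = (\<integral>\<omega>. f (X t \<omega>) \<partial>P s x)"

definition markov_process ::
    "'w measure \<Rightarrow> (real \<Rightarrow> 'a::euclidean_space \<Rightarrow> 'w measure) \<Rightarrow> (real \<Rightarrow> 'w \<Rightarrow> 'a) \<Rightarrow> bool"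
  where "markov_process M P X \<longleftrightarrow>
    (\<forall>t\<ge>0. X t \<in> borel_measurable M) \<and>
    (\<forall>s\<ge>0. P s \<in> borel \<rightarrow>\<^sub>M prob_algebra M) \<and>
    (\<forall>s\<ge>0. \<forall>x. AE \<omega> in P s x. X s \<omega> = x) \<and>
    (\<forall>s t u x f. 0 \<le> s \<and> s \<le> t \<and> t \<le> u \<and> f \<in> bounded_borel \<longrightarrow>
       (AE \<omega> in P s x.
          real_cond_exp (P s x) (past M X s t) (\<lambda>\<omega>. f (X u \<omega>)) \<omega>
            = markov_evolution P X t u f (X t \<omega>)))"

definition feller_evolution_system ::
    "(real \<Rightarrow> real \<Rightarrow> ('a::euclidean_space \<Rightarrow> real) \<Rightarrow> 'a \<Rightarrow> real) \<Rightarrow> bool"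
  where "feller_evolution_system T \<longleftrightarrow>
    (\<forall>s t. 0 \<le> s \<and> s \<le> t \<longrightarrow>
       (\<forall>f\<in>bounded_borel. T s t f \<in> bounded_borel) \<and>
       (\<forall>f\<in>bounded_borel. \<forall>g\<in>bounded_borel. \<forall>a b.
          T s t (\<lambda>x. a * f x + b * g x) = (\<lambda>x. a * T s t f x + b * T s t g x)) \<and>
       T s t (\<lambda>x. 1) = (\<lambda>x. 1)) \<and>
    (\<forall>s\<ge>0. \<forall>f\<in>bounded_borel. T s s f = f) \<and>
    (\<forall>s t. 0 \<le> s \<and> s \<le> t \<longrightarrow>
       (\<forall>f\<in>C0. T s t f \<in> C0 \<and> ((\<forall>x. 0 \<le> f x) \<longrightarrow> (\<forall>x. 0 \<le> T s t f x)) \<and>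
               sup_norm (T s t f) \<le> sup_norm f)) \<and>
    (\<forall>r s t. 0 \<le> r \<and> r \<le> s \<and> s \<le> t \<longrightarrow> (\<forall>f\<in>C0. T r s (T s t f) = T r t f)) \<and>
    (\<forall>s t. 0 \<le> s \<and> s \<le> t \<longrightarrow>
       (\<forall>f\<in>C0. ((\<lambda>(u, v). sup_norm (\<lambda>x. T u v f x - T s t f x)) \<longlongrightarrow> 0)
                 (at (s, t) within {(u, v). 0 \<le> u \<and> u \<le> v})))"

definition feller_evolution_process ::
    "'w measure \<Rightarrow> (real \<Rightarrow> 'a::euclidean_space \<Rightarrow> 'w measure) \<Rightarrow> (real \<Rightarrow> 'w \<Rightarrow> 'a) \<Rightarrow> bool"
  where "feller_evolution_process M P X \<longleftrightarrow>
    markov_process M P X \<and> feller_evolution_system (markov_evolution P X)"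

text \<open>
  Generators are represented by their graphs, so that \<open>Domain\<close> is the domain of the operator.
  When the symbols are continuous in the time parameter and bounded, the left and the right
  generator coincide (Boettcher). The common generator at time \<open>s\<close> is represented by the right
  one, which also makes sense for \<open>s = 0\<close>.
\<close>

type_synonym 'a operator = "(('a \<Rightarrow> real) \<times> ('a \<Rightarrow> real)) set"

definition right_generator ::
    "(real \<Rightarrow> real \<Rightarrow> ('a::euclidean_space \<Rightarrow> real) \<Rightarrow> 'a \<Rightarrow> real) \<Rightarrow> real \<Rightarrow> 'a operator"
  where "right_generator T s = {(f, g). f \<in> C0 \<and> g \<in> C0 \<and>
    ((\<lambda>h. sup_norm (\<lambda>x. (T s (s + h) f x - f x) / h - g x)) \<longlongrightarrow> 0) (at_right 0)}"

definition left_generator ::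
    "(real \<Rightarrow> real \<Rightarrow> ('a::euclidean_space \<Rightarrow> real) \<Rightarrow> 'a \<Rightarrow> real) \<Rightarrow> real \<Rightarrow> 'a operator"
  where "left_generator T s = {(f, g). f \<in> C0 \<and> g \<in> C0 \<and>
    ((\<lambda>h. sup_norm (\<lambda>x. (T (s - h) s f x - f x) / h - g x)) \<longlongrightarrow> 0) (at_right 0)}"

definition is_core :: "('a \<Rightarrow> real) set \<Rightarrow> 'a operator \<Rightarrow> bool"
  where "is_core D A \<longleftrightarrow>
    D \<subseteq> Domain A \<and>
    (\<lambda>x. 0) \<in> D \<and> (\<forall>f\<in>D. \<forall>g\<in>D. \<forall>a b. (\<lambda>x. a * f x + b * g x) \<in> D) \<and>
    (\<forall>(f, g)\<in>A. \<forall>\<epsilon>>0. \<exists>(\<phi>, \<psi>)\<in>A. \<phi> \<in> D \<and>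
       sup_norm (\<lambda>x. f x - \<phi> x) + sup_norm (\<lambda>x. g x - \<psi> x) < \<epsilon>)"

definition fourier :: "(real^'d \<Rightarrow> real) \<Rightarrow> real^'d \<Rightarrow> complex"
  where "fourier f \<xi> =
    (2 * pi) powr (- real CARD('d) / 2) *\<^sub>R (\<integral>x. cis (- (x \<bullet> \<xi>)) * of_real (f x) \<partial>lborel)"

text \<open>
  Integrability is part of the definition, since the Bochner integral of a non-integrable function
  is zero by convention.
\<close>

definition has_symbol :: "(real^'d) operator \<Rightarrow> (real^'d \<Rightarrow> real^'d \<Rightarrow> complex) \<Rightarrow> bool"
  where "has_symbol A p \<longleftrightarrow>
    (\<forall>(f, g)\<in>A. f \<in> Cc_infty \<longrightarrow>
       (\<forall>x. integrable lborel (\<lambda>\<xi>. cis (x \<bullet> \<xi>) * p x \<xi> * fourier f \<xi>) \<and>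
            complex_of_real (g x) =
              (2 * pi) powr (- real CARD('d) / 2) *\<^sub>R
                (\<integral>\<xi>. cis (x \<bullet> \<xi>) * p x \<xi> * fourier f \<xi> \<partial>lborel)))"

definition s_continuous :: "real set \<Rightarrow> (real \<Rightarrow> 'a \<Rightarrow> 'a \<Rightarrow> complex) \<Rightarrow> bool"
  where "s_continuous I p \<longleftrightarrow> (\<forall>x \<xi>. continuous_on I (\<lambda>s. p s x \<xi>))"

definition bounded_symbols ::
    "real set \<Rightarrow> (real \<Rightarrow> 'a::real_normed_vector \<Rightarrow> 'a \<Rightarrow> complex) \<Rightarrow> bool"
  where "bounded_symbols I p \<longleftrightarrow>
    (\<exists>C>0. \<forall>s\<in>I. \<forall>x \<xi>. cmod (p s x \<xi>) \<le> C * (1 + (norm \<xi>)\<^sup>2))"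

definition levy_measure :: "'a::euclidean_space measure \<Rightarrow> bool"
  where "levy_measure N \<longleftrightarrow>
    sets N = sets borel \<and> emeasure N {0} = 0 \<and>
    (\<integral>\<^sup>+y. ennreal (min 1 ((norm y)\<^sup>2)) \<partial>N) < \<infinity>"

definition chi :: "'a::real_normed_vector \<Rightarrow> real"
  where "chi y = indicator {0<..<1} (norm y)"

definition levy_khintchine ::
    "real^'d \<Rightarrow> real^'d^'d \<Rightarrow> (real^'d) measure \<Rightarrow> real^'d \<Rightarrow> complex"
  where "levy_khintchine b \<Sigma> N \<xi> =
    \<i> * of_real (b \<bullet> \<xi>) - of_real ((\<xi> \<bullet> (\<Sigma> *v \<xi>)) / 2) +
    (\<integral>y\<in>- {0}. (cis (\<xi> \<bullet> y) - 1 - \<i> * of_real ((\<xi> \<bullet> y) * chi y)) \<partial>N)"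

definition characteristic_triplet ::
    "(real^'d \<Rightarrow> real^'d \<Rightarrow> complex) \<Rightarrow> (real^'d \<Rightarrow> real^'d) \<Rightarrow> (real^'d \<Rightarrow> real^'d^'d) \<Rightarrow>
     (real^'d \<Rightarrow> (real^'d) measure) \<Rightarrow> bool"
  where "characteristic_triplet p b \<Sigma> N \<longleftrightarrow>
    (\<forall>x. transpose (\<Sigma> x) = \<Sigma> x \<and> (\<forall>\<xi>. 0 \<le> \<xi> \<bullet> (\<Sigma> x *v \<xi>)) \<and> levy_measure (N x) \<and>
         (\<forall>\<xi>. p x \<xi> = levy_khintchine (b x) (\<Sigma> x) (N x) \<xi>))"

text \<open>
  The expectations may be infinite and are therefore taken in \<open>ennreal\<close>. For a product on the
  right-hand side having both a zero and an infinite factor the convention \<open>0 * \<infinity> = 0\<close> applies;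
  the left-hand side is then zero as well.
\<close>

definition spatially_PUOD ::
    "(real \<Rightarrow> real^'d \<Rightarrow> 'w measure) \<Rightarrow> (real \<Rightarrow> 'w \<Rightarrow> real^'d) \<Rightarrow> bool"
  where "spatially_PUOD P X \<longleftrightarrow>
    (\<forall>s t x. 0 \<le> s \<and> s \<le> t \<longrightarrow>
      (\<forall>f :: 'd \<Rightarrow> real \<Rightarrow> real. (\<forall>i. mono (f i) \<and> (\<forall>y. 0 \<le> f i y)) \<longrightarrow>
        (\<Prod>i\<in>UNIV. \<integral>\<^sup>+\<omega>. ennreal (f i (X t \<omega> $ i)) \<partial>P s x)
          \<le> (\<integral>\<^sup>+\<omega>. ennreal (\<Prod>i\<in>UNIV. f i (X t \<omega> $ i)) \<partial>P s x)))"

definition nonneg_orthant :: "(real^'d) set"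
  where "nonneg_orthant = {y. \<forall>i. 0 \<le> y $ i}"

definition nonpos_orthant :: "(real^'d) set"
  where "nonpos_orthant = {y. \<forall>i. y $ i \<le> 0}"

end

theory Submission
  imports Defs
begin

text \<open>
  Fix \<open>s\<close> and \<open>x\<close>, and let \<open>y\<close> have a positive coordinate \<open>y $ i\<close> and a negative coordinate
  \<open>y $ j\<close>. It suffices to find a ball around \<open>y\<close> of measure zero under \<open>\<nu> s x\<close>, since countably
  many such balls cover the complement of the two orthants.

  Applied to indicators of half-lines in the coordinates \<open>i\<close> and \<open>j\<close> and to the constant one in the
  others, the dependence property says that the events \<open>X $ i > x $ i + \<epsilon>\<close> and \<open>X $ j > x $ j - \<epsilon>\<close>
  are positively correlated. Passing to the complement of the second event gives
  \<^emph>\<open>negative\<close> correlation: the probability that the process, started at time \<open>s\<close> in \<open>x\<close>, has by time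
  \<open>s + h\<close> moved up by \<open>\<epsilon>\<close> in coordinate \<open>i\<close> and down by \<open>\<epsilon>\<close> in coordinate \<open>j\<close> is at most the product
  of the two separate probabilities (\<open>PUOD_opposite_tails\<close>). A smooth bump at \<open>x\<close> lies in the domain
  of the generator, so either of these is \<open>O(h)\<close>, and the product is \<open>O(h\<^sup>2)\<close>. Dividing by \<open>h\<close> and
  letting \<open>h\<close> tend to zero, the generator vanishes at \<open>x\<close> on every smooth bump \<open>f\<close> that is
  supported in a small ball around \<open>x + y\<close> (\<open>PUOD_generator_zero\<close>).

  Write \<open>\<nu>\<close> for \<open>\<nu> s x\<close>. For such an \<open>f\<close>, which vanishes near \<open>x\<close>, the value of the generator
  at \<open>x\<close> should be \<open>\<integral> f(x + v) \<nu>(dv)\<close>, which forces \<open>\<nu>\<close> to vanish near \<open>y\<close>.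
  The generator is however only given through the Fourier transform of \<open>f\<close> and the symbol, so Fourier inversion is needed. It is
  replaced by the following regularisation. Multiply the Fourier transform of \<open>f\<close> by
  \<open>\<Prod>\<^sub>b sinc (a \<xi>\<^sub>b)\<^sup>4\<close>. As \<open>a\<close> tends to zero, the integral over \<open>\<xi>\<close> converges to the original one by
  dominated convergence. The multiplier decays fast enough for the Levy-Khintchine integral and the
  integral over \<open>\<xi>\<close> to be exchanged, and it is the Fourier transform of a \<^emph>\<open>compactly supported\<close>
  nonnegative function, a product of cubic B-splines: by Levy's inversion formula the
  B-spline is, up to a factor, the probability that a sum of three uniform variables lies in an
  interval. Hence the regularised \<open>f\<close> still vanishes identically in a neighbourhood of \<open>x\<close>, so that
  the drift and the compensator disappear exactly, with no error term to estimate, and it is still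
  bounded below near \<open>x + y\<close> (\<open>levy_measure_null_ball\<close>).
\<close>

section \<open>Smooth bump functions\<close>

text \<open>The factors \<open>1 / t ^ n\<close> make the family closed under differentiation up to linear combinations.\<close>

definition flat :: "nat \<Rightarrow> real \<Rightarrow> real"
  where "flat n t = (if t \<le> 0 then 0 else exp (- 1 / t) / t ^ n)"

lemma flat_tendsto_0: "(flat n \<longlongrightarrow> 0) (at 0)"
proof -
  have "((\<lambda>t. inverse t ^ n / exp (inverse t :: real)) \<longlongrightarrow> 0) (at_right 0)"
    by (rule filterlim_compose[OF tendsto_power_div_exp_0 filterlim_inverse_at_top_right])
  moreover have "\<forall>\<^sub>F t in at_right 0. inverse t ^ n / exp (inverse t) = flat n t"
    unfolding eventually_at_right_field
    by (intro exI[of _ 1]) (auto simp: flat_def exp_minus field_simps)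
  ultimately have right: "(flat n \<longlongrightarrow> 0) (at_right 0)"
    by (rule Lim_transform_eventually)
  have "\<forall>\<^sub>F t in at_left 0. flat n t = 0"
    by (auto simp: eventually_at_left_field flat_def intro: exI[of _ "-1"])
  then have "(flat n \<longlongrightarrow> 0) (at_left 0)"
    by (rule tendsto_eventually)
  with right show ?thesis by (simp add: filterlim_split_at)
qed

lemma flat_has_derivative:
  "(flat n has_real_derivative flat (n + 2) t - real n * flat (n + 1) t) (at t)"
proof -
  consider "t < 0" | "t = 0" | "t > 0" by linarith
  then show ?thesis
  proof cases
    case 1
    have "((\<lambda>t. 0) has_real_derivative 0) (at t)" by simp
    moreover have "\<forall>\<^sub>F u in nhds t. flat n u = 0"
      using 1 by (auto simp: eventually_nhds flat_def intro!: exI[of _ "{..<0}"])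
    ultimately have "(flat n has_real_derivative 0) (at t)"
      by (subst DERIV_cong_ev[OF refl _ refl]) auto
    then show ?thesis using 1 by (simp add: flat_def)
  next
    case 2
    have "(flat n (0 + h) - flat n 0) / h = flat (n + 1) h" for h
      by (auto simp: flat_def)
    then have "(flat n has_real_derivative 0) (at 0)"
      unfolding DERIV_def using flat_tendsto_0[of "n + 1"] by simp
    then show ?thesis
      using 2 by (simp add: flat_def)
  next
    case 3
    have "((\<lambda>t. exp (- 1 / t) / t ^ n) has_real_derivative
        ((exp (- 1 / t) * (1 / t\<^sup>2)) * t ^ n - exp (- 1 / t) * (real n * t ^ (n - 1))) / (t ^ n * t ^ n)) (at t)"
      using 3 by (auto intro!: derivative_eq_intros simp: power2_eq_square)
    also have "((exp (- 1 / t) * (1 / t\<^sup>2)) * t ^ n - exp (- 1 / t) * (real n * t ^ (n - 1))) / (t ^ n * t ^ n)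
        = flat (n + 2) t - real n * flat (n + 1) t"
      using 3 by (cases n) (simp_all add: flat_def field_simps power2_eq_square)
    finally have D: "((\<lambda>t. exp (- 1 / t) / t ^ n) has_real_derivative
        flat (n + 2) t - real n * flat (n + 1) t) (at t)" .
    have "\<forall>\<^sub>F u in nhds t. exp (- 1 / u) / u ^ n = flat n u"
      using 3 by (auto simp: eventually_nhds flat_def intro!: exI[of _ "{0<..}"])
    with D show ?thesis
      by (subst (asm) DERIV_cong_ev[OF refl _ refl]) auto
  qed
qed

text \<open>
  An algebra of functions that contains the bump with centre \<open>c\<close> and squared radius \<open>R\<close> and is stable
  under directional derivatives. Stability alone gives smoothness, by induction on the order.
\<close>

inductive_set flat_algebra :: "'a \<Rightarrow> real \<Rightarrow> ('a::euclidean_space \<Rightarrow> real) set"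
  for c :: 'a and R :: real where
  const: "(\<lambda>x. a) \<in> flat_algebra c R"
| inner: "(\<lambda>x. x \<bullet> v) \<in> flat_algebra c R"
| flat: "(\<lambda>x. flat n (R - (x - c) \<bullet> (x - c))) \<in> flat_algebra c R"
| add: "f \<in> flat_algebra c R \<Longrightarrow> g \<in> flat_algebra c R \<Longrightarrow> (\<lambda>x. f x + g x) \<in> flat_algebra c R"
| mult: "f \<in> flat_algebra c R \<Longrightarrow> g \<in> flat_algebra c R \<Longrightarrow> (\<lambda>x. f x * g x) \<in> flat_algebra c R"

text \<open>
  The chain rule turns the derivative of \<open>flat n\<close> composed with the quadratic form into
  \<open>flat (n + 2)\<close> and \<open>flat (n + 1)\<close> composed with it, times an affine function; the product rule does
  the rest.
\<close>

lemma flat_algebra_derivative: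
  assumes "f \<in> flat_algebra c R"
  shows "\<exists>f'. (\<forall>x. (f has_derivative f' x) (at x)) \<and> (\<forall>v. (\<lambda>x. f' x v) \<in> flat_algebra c R)"
  using assms
proof induction
  case (const a)
  show ?case
    by (rule exI[of _ "\<lambda>x v. 0"]) (auto intro: flat_algebra.const)
next
  case (inner w)
  show ?case
    by (rule exI[of _ "\<lambda>x v. v \<bullet> w"]) (auto intro!: derivative_eq_intros flat_algebra.const)
next
  case (flat n)
  let ?q = "\<lambda>x. R - (x - c) \<bullet> (x - c)"
  let ?D = "\<lambda>x v. (flat (n + 2) (?q x) + (- real n) * flat (n + 1) (?q x)) * ((-2) * (x \<bullet> v + - (c \<bullet> v)))"
  have "((\<lambda>x. flat n (?q x)) has_derivative ?D x) (at x)" for x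
  proof -
    have "(?q has_derivative (\<lambda>v. - 2 * ((x - c) \<bullet> v))) (at x)"
      by (auto intro!: derivative_eq_intros simp: inner_commute)
    moreover have "(flat n has_derivative
        (\<lambda>h. (flat (n + 2) (?q x) - real n * flat (n + 1) (?q x)) * h)) (at (?q x))"
      using flat_has_derivative[of n "?q x"] by (simp add: has_field_derivative_def)
    ultimately have "((\<lambda>x. flat n (?q x)) has_derivative
        (\<lambda>v. (flat (n + 2) (?q x) - real n * flat (n + 1) (?q x)) * (- 2 * ((x - c) \<bullet> v)))) (at x)"
      by (rule has_derivative_compose)
    then show ?thesis by (simp add: inner_diff_left)
  qed
  moreover have "(\<lambda>x. ?D x v) \<in> flat_algebra c R" for v
    by (intro flat_algebra.intros)
  ultimately show ?case by (intro exI[of _ ?D]) auto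
next
  case (add f g)
  then obtain f' g' where
    "\<And>x. (f has_derivative f' x) (at x)" "\<And>v. (\<lambda>x. f' x v) \<in> flat_algebra c R"
    "\<And>x. (g has_derivative g' x) (at x)" "\<And>v. (\<lambda>x. g' x v) \<in> flat_algebra c R" by blast
  then show ?case
    by (intro exI[of _ "\<lambda>x v. f' x v + g' x v"])
      (auto intro!: derivative_eq_intros flat_algebra.add)
next
  case (mult f g)
  then obtain f' g' where
    "\<And>x. (f has_derivative f' x) (at x)" "\<And>v. (\<lambda>x. f' x v) \<in> flat_algebra c R"
    "\<And>x. (g has_derivative g' x) (at x)" "\<And>v. (\<lambda>x. g' x v) \<in> flat_algebra c R" by blast
  with mult.hyps show ?case
    by (intro exI[of _ "\<lambda>x v. f x * g' x v + f' x v * g x"])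
      (auto intro!: has_derivative_mult flat_algebra.add flat_algebra.mult)
qed

lemma flat_algebra_C_times: "f \<in> flat_algebra c R \<Longrightarrow> C_times k f"
proof (induction k arbitrary: f)
  case 0
  then obtain f' where "\<And>x. (f has_derivative f' x) (at x)"
    using flat_algebra_derivative by blast
  then show ?case
    by (auto intro!: continuous_at_imp_continuous_on has_derivative_continuous)
next
  case (Suc k)
  then obtain f' where f': "\<And>x. (f has_derivative f' x) (at x)" "\<And>v. (\<lambda>x. f' x v) \<in> flat_algebra c R"
    using flat_algebra_derivative by blast
  from f'(1) have "frechet_derivative f (at x) = f' x" for x
    by (metis frechet_derivative_at)
  with f' Suc.IH show ?case
    by (auto simp: differentiable_def)
qed

text \<open>The factor in front normalises the maximum, attained at the centre, to one.\<close>

definition bump :: "'a::euclidean_space \<Rightarrow> real \<Rightarrow> 'a \<Rightarrow> real"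
  where "bump c r x = exp (1 / r\<^sup>2) * flat 0 (r\<^sup>2 - (x - c) \<bullet> (x - c))"

lemma bump_nonneg: "0 \<le> bump c r x"
  by (simp add: bump_def flat_def)

lemma bump_centre: "r > 0 \<Longrightarrow> bump c r c = 1"
  by (simp add: bump_def flat_def exp_minus)

lemma bump_le_1: 
  assumes "r > 0" shows "bump c r x \<le> 1"
proof (cases "(x - c) \<bullet> (x - c) < r\<^sup>2")
  case True
  then have "1 / r\<^sup>2 \<le> 1 / (r\<^sup>2 - (x - c) \<bullet> (x - c))"
    by (intro divide_left_mono mult_pos_pos) (use assms True in auto)
  with True show ?thesis by (simp add: bump_def flat_def flip: exp_add)
qed (simp add: bump_def flat_def)

lemma bump_eq_0:
  assumes "r > 0" "r \<le> dist c x" shows "bump c r x = 0"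
proof -
  have "r\<^sup>2 \<le> (x - c) \<bullet> (x - c)"
    using assms by (simp add: dot_square_norm dist_norm norm_minus_commute power_mono)
  then show ?thesis by (simp add: bump_def flat_def)
qed

lemma bump_in_Cc_infty:
  assumes "r > 0" shows "bump c r \<in> Cc_infty"
proof -
  have "bump c r \<in> flat_algebra c (r\<^sup>2)"
    unfolding bump_def[abs_def] by (intro flat_algebra.intros)
  then have "C_times k (bump c r)" for k
    by (rule flat_algebra_C_times)
  moreover have "{x. bump c r x \<noteq> 0} \<subseteq> cball c r"
    using bump_eq_0[OF assms] by (force simp: subset_eq not_le)
  then have "compact (closure {x. bump c r x \<noteq> 0})"
    by (meson bounded_cball bounded_subset compact_closure)
  ultimately show ?thesis by (simp add: Cc_infty_def)
qed

lemma bump_continuous: "r > 0 \<Longrightarrow> continuous_on UNIV (bump c r)"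
  using bump_in_Cc_infty[of r c] by (auto simp: Cc_infty_def dest!: spec[of _ 0])

lemma bump_integrable:
  assumes r: "r > 0" shows "integrable lborel (bump c r)"
proof (rule Bochner_Integration.integrable_bound)
  show "integrable lborel (indicator (cball c r) :: _ \<Rightarrow> real)"
    using emeasure_bounded_finite[of "cball c r"] by (intro integrable_real_indicator) auto
  show "bump c r \<in> borel_measurable lborel"
    using borel_measurable_continuous_onI[OF bump_continuous[OF r]] by simp
  show "AE x in lborel. norm (bump c r x) \<le> norm (indicator (cball c r) x :: real)"
    using bump_nonneg[of c r] bump_le_1[OF r, of c] bump_eq_0[OF r, of c]
    by (intro AE_I2) (auto simp: indicator_def)
qed

lemma bump_pos_near_centre:
  assumes r: "r > 0"
  obtains \<rho> where "\<rho> > 0" "\<And>u. dist c u < 2 * \<rho> \<Longrightarrow> 1 / 2 \<le> bump c r u"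
proof -
  have "isCont (bump c r) c"
    using bump_continuous[OF r, of c] by (simp add: continuous_on_eq_continuous_at)
  then obtain d where d: "d > 0" "\<And>u. dist u c < d \<Longrightarrow> dist (bump c r u) (bump c r c) < 1 / 2"
    unfolding continuous_at_eps_delta by (metis half_gt_zero zero_less_one)
  show ?thesis
  proof (rule that[of "d / 2"])
    fix u assume "dist c u < 2 * (d / 2)"
    then show "1 / 2 \<le> bump c r u"
      using d(2)[of u] bump_centre[OF r, of c] by (simp add: dist_commute dist_real_def abs_if split: if_splits)
  qed (use d in simp)
qed

section \<open>Fourier inversion for a cubic B-spline\<close>

abbreviation uniform_distribution :: "real \<Rightarrow> real measure"
  where "uniform_distribution a \<equiv> uniform_measure lborel {-a..a}"

lemma real_distribution_uniform: "a > 0 \<Longrightarrow> real_distribution (uniform_distribution a)"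
  by (intro real_distribution.intro prob_space_uniform_measure real_distribution_axioms.intro)
    (auto simp: ennreal_eq_0_iff)

lemma uniform_distribution_density:
  "a > 0 \<Longrightarrow> uniform_distribution a = density lborel (\<lambda>x. ennreal (indicator {-a..a} x / (2 * a)))"
  unfolding uniform_measure_def
  by (intro density_cong) (auto simp: divide_ennreal indicator_def simp flip: ennreal_1)

lemma char_uniform_distribution:
  assumes a: "a > 0"
  shows "char (uniform_distribution a) t = of_real (sinc (a * t))"
proof -
  have "char (uniform_distribution a) t
      = (\<integral>x. (indicator {-a..a} x / (2 * a)) *\<^sub>R iexp (t * x) \<partial>lborel)"
    unfolding char_def uniform_distribution_density[OF a]
    by (subst integral_density) (use a in auto)
  also have "\<dots> = (1 / (2 * a)) *\<^sub>R (\<integral>x. indicator {-a..a} x *\<^sub>R iexp (t * x) \<partial>lborel)"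
    by (simp flip: integral_scaleR_right)
  also have "(\<integral>x. indicator {-a..a} x *\<^sub>R iexp (t * x) \<partial>lborel) = of_real (2 * a * sinc (a * t))"
  proof (cases "t = 0")
    case True
    then show ?thesis using a by (simp add: scaleR_conv_of_real)
  next
    case False
    have "(\<integral>x. indicator {-a..a} x *\<^sub>R iexp (t * x) \<partial>lborel)
        = (- \<i> / t) * iexp (t * a) - (- \<i> / t) * iexp (t * (- a))"
      using a False
      by (intro integral_FTC_Icc)
        (auto intro!: derivative_eq_intros continuous_intros has_vector_derivative_real_field
          simp: has_vector_derivative_complex_iff Re_exp Im_exp)
    also have "\<dots> = of_real (2 * a * sinc (a * t))"
      using a False
      by (simp add: complex_eq_iff Re_exp Im_exp mult.commute)
    finally show ?thesis .
  qed
  finally show ?thesis using a by (simp add: scaleR_conv_of_real)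
qed

lemma real_distribution_convolution:
  assumes "real_distribution M" "real_distribution N"
  shows "real_distribution (convolution M N)"
proof -
  interpret M: real_distribution M by fact
  interpret N: real_distribution N by fact
  interpret pair_prob_space M N ..
  show ?thesis
    unfolding convolution_def
    by (intro real_distribution.intro prob_space_distr real_distribution_axioms.intro) auto
qed

lemma char_convolution:
  assumes "real_distribution M" "real_distribution N"
  shows "char (convolution M N) t = char M t * char N t"
proof -
  interpret M: real_distribution M by fact
  interpret N: real_distribution N by fact
  interpret pair_prob_space M N ..
  have "char (convolution M N) t = (\<integral>p. iexp (t * (fst p + snd p)) \<partial>(M \<Otimes>\<^sub>M N))"
    unfolding char_def convolution_def by (subst integral_distr) (auto simp: case_prod_beta)
  also have "\<dots> = (\<integral>x. (\<integral>y. iexp (t * (x + y)) \<partial>N) \<partial>M)"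
    by (subst integral_fst'[symmetric]) (auto intro!: integrable_iexp)
  also have "\<dots> = (\<integral>x. iexp (t * x) * (\<integral>y. iexp (t * y) \<partial>N) \<partial>M)"
    by (simp add: distrib_left exp_add)
  also have "\<dots> = char M t * char N t"
    by (simp add: char_def)
  finally show ?thesis .
qed

lemma convolution_bounded:
  assumes "real_distribution M" "real_distribution N"
    and "AE x in M. \<bar>x\<bar> \<le> A" "AE x in N. \<bar>x\<bar> \<le> B"
  shows "AE x in convolution M N. \<bar>x\<bar> \<le> A + B"
proof -
  interpret M: real_distribution M by fact
  interpret N: real_distribution N by fact
  interpret pair_prob_space M N ..
  have "AE x in M. AE y in N. \<bar>x + y\<bar> \<le> A + B"
    using assms(3)
  proof eventually_elim
    case (elim x)
    show ?case using assms(4) by eventually_elim (use elim in linarith)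
  qed
  moreover have "{p \<in> space (M \<Otimes>\<^sub>M N). \<bar>fst p + snd p\<bar> \<le> A + B} \<in> sets (M \<Otimes>\<^sub>M N)"
    by measurable
  ultimately have "AE p in M \<Otimes>\<^sub>M N. \<bar>fst p + snd p\<bar> \<le> A + B"
    by (intro AE_pair_measure) auto
  then show ?thesis
    unfolding convolution_def by (subst AE_distr_iff) (auto simp: case_prod_beta)
qed

text \<open>
  Atoms must be excluded because the inversion formula gives the mass of an interval only when its
  end points carry no mass.
\<close>

lemma convolution_atomless:
  assumes "real_distribution M" "real_distribution N" and "\<And>z. emeasure N {z} = 0"
  shows "emeasure (convolution M N) {z} = 0"
proof -
  interpret M: real_distribution M by fact
  interpret N: real_distribution N by fact
  have "emeasure (convolution M N) {z} = (\<integral>\<^sup>+x. \<integral>\<^sup>+y. indicator {z} (x + y) \<partial>N \<partial>M)"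
    by (intro convolution_emeasure') (auto intro: M.finite_measure_axioms N.finite_measure_axioms)
  also have "\<dots> = (\<integral>\<^sup>+x. \<integral>\<^sup>+y. indicator {z - x} y \<partial>N \<partial>M)"
    by (intro nn_integral_cong) (auto simp: indicator_def)
  also have "\<dots> = 0"
    using assms(3) by simp
  finally show ?thesis .
qed

text \<open>
  Levy's inversion formula for an interval of length \<open>2 * a\<close> already contains a factor
  \<open>sinc (a * t)\<close>, namely the transform of the indicator of the interval. If the integrand is
  absolutely integrable, the improper integral of the formula is a genuine one. Analytically this is
  Fourier inversion for the density of the sum of \<open>M\<close> and a uniform variable.
\<close>

lemma (in real_distribution) sinc_char_inversion:
  assumes a: "a > 0" and atomless: "\<And>z. emeasure M {z} = 0"
    and int: "integrable lborel (\<lambda>t. of_real (sinc (a * t)) * char M t)"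
  shows "(\<integral>t. iexp (- (t * z)) * (of_real (sinc (a * t)) * char M t) \<partial>lborel)
    = of_real (pi / a * measure M {z - a<..z + a})"
proof -
  let ?F = "\<lambda>t. (iexp (- (t * (z - a))) - iexp (- (t * (z + a)))) / (\<i> * t) * char M t"
  let ?G = "\<lambda>t. iexp (- (t * z)) * (of_real (sinc (a * t)) * char M t)"
  \<comment> \<open>At \<open>t = 0\<close> the left-hand side is zero by the convention for division, so the two agree only almost everywhere.\<close>
  have FG: "?F t = 2 * a * ?G t" if "t \<noteq> 0" for t
  proof -
    have "iexp (- (t * (z - a))) = iexp (- (t * z)) * iexp (a * t)"
      "iexp (- (t * (z + a))) = iexp (- (t * z)) * iexp (- (a * t))"
      by (simp_all add: algebra_simps flip: exp_add)
    moreover have "iexp (a * t) - iexp (- (a * t)) = 2 * \<i> * of_real (sin (a * t))"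
      by (simp add: complex_eq_iff Re_exp Im_exp)
    ultimately have "iexp (- (t * (z - a))) - iexp (- (t * (z + a)))
        = iexp (- (t * z)) * (2 * \<i> * of_real (sin (a * t)))"
      by (metis right_diff_distrib)
    then show ?thesis using that a by (simp add: field_simps)
  qed
  have G: "integrable lborel ?G"
    by (rule Bochner_Integration.integrable_bound[OF int])
      (auto simp: norm_mult)
  have "(\<lambda>n. 1 / (2 * pi) * (CLBINT t=-real n..real n. ?F t)) \<longlonglongrightarrow> measure M {z - a<..z + a}"
    using Levy_Inversion[of "z - a" "z + a"] a atomless by (simp add: measure_def)
  moreover have "(CLBINT t=-real n..real n. ?F t)
      = (\<integral>t. indicator {- real n<..<real n} t *\<^sub>R (2 * a * ?G t) \<partial>lborel)" for n
  proof -
    have "(CLBINT t=-real n..real n. ?F t) = (\<integral>t. indicator {- real n<..<real n} t *\<^sub>R ?F t \<partial>lborel)"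
      by (simp add: interval_lebesgue_integral_def set_lebesgue_integral_def)
    also have "\<dots> = (\<integral>t. indicator {- real n<..<real n} t *\<^sub>R (2 * a * ?G t) \<partial>lborel)"
    proof (intro integral_cong_AE)
      show "AE t in lborel. indicator {- real n<..<real n} t *\<^sub>R ?F t
          = indicator {- real n<..<real n} t *\<^sub>R (2 * a * ?G t)"
        using AE_lborel_singleton[of 0] by eventually_elim (simp only: FG not_False_eq_True)
    qed auto
    finally show ?thesis .
  qed
  moreover have "(\<lambda>n. \<integral>t. indicator {- real n<..<real n} t *\<^sub>R (2 * a * ?G t) \<partial>lborel)
      \<longlonglongrightarrow> (\<integral>t. 2 * a * ?G t \<partial>lborel)"
  proof (rule integral_dominated_convergence)
    show "integrable lborel (\<lambda>t. norm (2 * a * ?G t))"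
      using G by (intro integrable_norm integrable_mult_right)
    show "AE t in lborel. (\<lambda>n. indicator {- real n<..<real n} t *\<^sub>R (2 * a * ?G t)) \<longlonglongrightarrow> 2 * a * ?G t"
    proof (intro AE_I2 tendsto_eventually)
      fix t :: real
      obtain m where m: "\<bar>t\<bar> < real m" using reals_Archimedean2 by blast
      then show "\<forall>\<^sub>F n in sequentially. indicator {- real n<..<real n} t *\<^sub>R (2 * a * ?G t) = 2 * a * ?G t"
        by (intro eventually_sequentiallyI[of m]) (auto simp: indicator_def)
    qed
  qed (use G in \<open>auto simp: indicator_def\<close>)
  then have "(\<lambda>n. 1 / (2 * pi) * (\<integral>t. indicator {- real n<..<real n} t *\<^sub>R (2 * a * ?G t) \<partial>lborel))
      \<longlonglongrightarrow> 1 / (2 * pi) * (2 * a * (\<integral>t. ?G t \<partial>lborel))"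
    by (intro tendsto_mult tendsto_const) simp
  ultimately have "of_real (measure M {z - a<..z + a}) = 1 / (2 * pi) * (2 * a * (\<integral>t. ?G t \<partial>lborel))"
    by (simp only:) (rule LIMSEQ_unique)
  then show ?thesis using a by (simp add: field_simps)
qed

text \<open>The law of a sum of \<open>n\<close> independent variables that are uniform on \<open>[-a, a]\<close>.\<close>

primrec uniform_sum :: "real \<Rightarrow> nat \<Rightarrow> real measure" where
  "uniform_sum a 0 = return borel 0"
| "uniform_sum a (Suc n) = convolution (uniform_sum a n) (uniform_distribution a)"

lemma real_distribution_uniform_sum: "a > 0 \<Longrightarrow> real_distribution (uniform_sum a n)"
proof (induction n)
  case 0
  show ?case
    by (auto intro!: real_distribution.intro prob_space_return real_distribution_axioms.intro)
qed (simp add: real_distribution_convolution real_distribution_uniform)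

lemma char_uniform_sum: "a > 0 \<Longrightarrow> char (uniform_sum a n) t = of_real (sinc (a * t) ^ n)"
proof (induction n)
  case 0
  show ?case by (simp add: char_def integral_return)
next
  case (Suc n)
  have "char (uniform_sum a (Suc n)) t = char (uniform_sum a n) t * char (uniform_distribution a) t"
    using Suc.prems
    by (simp only: uniform_sum.simps char_convolution real_distribution_uniform real_distribution_uniform_sum)
  then show ?case
    using Suc by (simp only: char_uniform_distribution power_Suc2 of_real_mult)
qed

lemma uniform_sum_bounded: "a > 0 \<Longrightarrow> AE x in uniform_sum a n. \<bar>x\<bar> \<le> real n * a"
proof (induction n)
  case 0
  have "AE x in return borel (0::real). \<bar>x\<bar> \<le> 0"
    by (subst AE_return) auto
  then show ?case by (simp only: uniform_sum.simps) simp
next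
  case (Suc n)
  have "AE x in uniform_distribution a. \<bar>x\<bar> \<le> a"
    by (rule AE_uniform_measureI) auto
  then have "AE x in uniform_sum a (Suc n). \<bar>x\<bar> \<le> real n * a + a"
    using Suc unfolding uniform_sum.simps
    by (intro convolution_bounded real_distribution_uniform real_distribution_uniform_sum) auto
  then show ?case by (simp add: algebra_simps)
qed

lemma uniform_sum_atomless:
  assumes "a > 0" shows "emeasure (uniform_sum a (Suc n)) {z} = 0"
proof -
  have "emeasure (uniform_distribution a) {z} = 0" for z
  proof -
    have "emeasure lborel ({- a..a} \<inter> {z}) \<le> emeasure lborel {z}"
      by (intro emeasure_mono) auto
    then show ?thesis by simp
  qed
  with assms show ?thesis
    by (simp add: convolution_atomless real_distribution_uniform real_distribution_uniform_sum)
qed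

text \<open>
  Up to the factor \<open>2 * pi\<close>, this is the density of the sum of four independent uniform variables on
  \<open>[-a, a]\<close>, a cubic B-spline: three of them make up \<open>uniform_sum a 3\<close>, and the fourth is the
  interval. The interval is reflected so that the kernel is the transform of \<open>sinc (a * t) ^ 4\<close> with
  a plus sign in the exponent.
\<close>

definition kernel :: "real \<Rightarrow> real \<Rightarrow> real"
  where "kernel a z = pi / a * measure (uniform_sum a 3) {- z - a<..- z + a}"

lemma kernel_nonneg: "a > 0 \<Longrightarrow> 0 \<le> kernel a z"
  by (simp add: kernel_def)

text \<open>The interval of half-width \<open>a\<close> around \<open>- z\<close> then misses the support \<open>[- 3 * a, 3 * a]\<close> of the sum.\<close>

lemma kernel_eq_0:
  assumes "a > 0" "\<bar>z\<bar> > 4 * a" shows "kernel a z = 0"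
proof -
  have "AE x in uniform_sum a 3. x \<notin> {- z - a<..- z + a}"
    using uniform_sum_bounded[OF assms(1), of 3]
    by eventually_elim (use assms(2) in auto)
  moreover have "sets (uniform_sum a 3) = sets borel"
    using real_distribution.events_eq_borel real_distribution_uniform_sum[OF assms(1)] by blast
  ultimately have "measure (uniform_sum a 3) {- z - a<..- z + a} = 0"
    by (intro measure_eq_0_null_sets AE_iff_null_sets[THEN iffD2]) auto
  then show ?thesis by (simp add: kernel_def)
qed

text \<open>
  By Tonelli, integrating the mass of a moving interval of length \<open>2 * a\<close> over its position gives
  \<open>2 * a\<close> times the total mass, which is one.
\<close>

lemma kernel_integral:
  assumes a: "a > 0"
  shows "has_bochner_integral lborel (kernel a) (2 * pi)"
proof -
  define M where "M = uniform_sum a 3"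
  interpret M: real_distribution M
    unfolding M_def by (rule real_distribution_uniform_sum[OF a])
  interpret L: pair_sigma_finite lborel M ..
  have ind: "(\<lambda>(z, w). indicator {- z - a<..- z + a} w :: ennreal) \<in> borel_measurable (lborel \<Otimes>\<^sub>M M)"
    unfolding indicator_def greaterThanAtMost_iff case_prod_beta by measurable
  have eq: "ennreal (kernel a z) = ennreal (pi / a) * (\<integral>\<^sup>+w. indicator {- z - a<..- z + a} w \<partial>M)" for z
    using a by (simp add: kernel_def M_def[symmetric] M.emeasure_eq_measure flip: ennreal_mult')
  have meas: "(\<lambda>z. \<integral>\<^sup>+w. indicator {- z - a<..- z + a} w \<partial>M) \<in> borel_measurable lborel"
    using M.borel_measurable_nn_integral[OF ind] by simp
  then have "(\<lambda>z. enn2real (ennreal (kernel a z))) \<in> borel_measurable lborel"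
    unfolding eq by measurable
  then have [measurable]: "kernel a \<in> borel_measurable borel"
    using kernel_nonneg[OF a] by simp
  have "(\<integral>\<^sup>+z. kernel a z \<partial>lborel)
      = ennreal (pi / a) * (\<integral>\<^sup>+z. \<integral>\<^sup>+w. indicator {- z - a<..- z + a} w \<partial>M \<partial>lborel)"
    unfolding eq using meas by (intro nn_integral_cmult) simp
  also have "(\<integral>\<^sup>+z. \<integral>\<^sup>+w. indicator {- z - a<..- z + a} w \<partial>M \<partial>lborel)
      = (\<integral>\<^sup>+w. \<integral>\<^sup>+z. indicator {- z - a<..- z + a} w \<partial>lborel \<partial>M)"
    by (rule L.Fubini'[OF ind, symmetric])
  also have "\<dots> = (\<integral>\<^sup>+w. \<integral>\<^sup>+z. indicator {- w - a<..- w + a} z \<partial>lborel \<partial>M)"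
    by (intro nn_integral_cong) (auto simp: indicator_def)
  also have "\<dots> = ennreal (2 * a)"
    using a M.emeasure_space_1 by simp
  finally have "(\<integral>\<^sup>+z. kernel a z \<partial>lborel) = ennreal (2 * pi)"
    using a by (simp flip: ennreal_mult)
  then show ?thesis
    using kernel_nonneg[OF a] by (intro has_bochner_integral_nn_integral) auto
qed

lemma integrable_inverse_1_plus_square: "integrable lborel (\<lambda>t::real. 1 / (1 + t\<^sup>2))"
proof -
  have "set_integrable lborel {0<..} (\<lambda>x::real. 1 / (1 + x\<^sup>2))"
    using integrable_I0i_1_div_plus_square
    by (simp add: interval_lebesgue_integrable_def zero_ereal_def)
  then have pos: "integrable lborel (\<lambda>x::real. indicator {0<..} x *\<^sub>R (1 / (1 + x\<^sup>2)))"
    by (simp add: set_integrable_def)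
  have "integrable lborel (\<lambda>x::real. indicator {0<..} (0 + (-1) * x) *\<^sub>R (1 / (1 + (0 + (-1) * x)\<^sup>2)))"
    by (rule lborel_integrable_real_affine[OF pos]) simp
  from Bochner_Integration.integrable_add[OF pos this]
  show ?thesis
  proof (rule integrable_cong_AE_imp)
    show "AE x in lborel. indicator {0<..} x *\<^sub>R (1 / (1 + x\<^sup>2))
        + indicator {0<..} (0 + (-1) * x) *\<^sub>R (1 / (1 + (0 + (-1) * x)\<^sup>2)) = 1 / (1 + (x::real)\<^sup>2)"
      using AE_lborel_singleton[of 0] by eventually_elim (auto simp: indicator_def)
  qed auto
qed

lemma abs_sinc_le: "\<bar>sinc x\<bar> \<le> 1"
  using abs_sin_x_le_abs_x[of x] by (auto simp: divide_le_eq)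

lemma sinc_4_le_1: "sinc x ^ 4 \<le> 1"
proof -
  have "s ^ 4 \<le> 1" if "\<bar>s\<bar> \<le> 1" for s :: real
    using power_le_one[of "\<bar>s\<bar>" 4] that by simp
  then show ?thesis using abs_sinc_le by blast
qed

text \<open>
  The fourth power is the smallest that works: symbols grow quadratically, so the multiplier has to
  be integrable against \<open>1 + t\<^sup>2\<close>.
\<close>

lemma integrable_sinc_4:
  assumes a: "a > 0"
  shows "integrable lborel (\<lambda>t. (1 + t\<^sup>2) * sinc (a * t) ^ 4)"
proof -
  \<comment> \<open>The two entries bound the cases \<open>\<bar>t\<bar> \<le> 1\<close> and \<open>\<bar>t\<bar> > 1\<close>; in both, \<open>1 + t\<^sup>2\<close> is at most twice the larger summand.\<close>
  define C where "C = 4 * max 1 (1 / a ^ 4)"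
  have bound: "(1 + t\<^sup>2) * sinc (a * t) ^ 4 \<le> C * (1 / (1 + t\<^sup>2))" for t
  proof -
    have pos: "0 < 1 + t\<^sup>2" by (simp add: add_pos_nonneg)
    have "(1 + t\<^sup>2)\<^sup>2 * sinc (a * t) ^ 4 \<le> C"
    proof (cases "\<bar>t\<bar> \<le> 1")
      case True
      then have "t\<^sup>2 \<le> 1" by (simp add: abs_square_le_1)
      then have "(1 + t\<^sup>2)\<^sup>2 \<le> 2\<^sup>2" by (intro power_mono) auto
      moreover have "sinc (a * t) ^ 4 \<le> 1" by (rule sinc_4_le_1)
      ultimately have "(1 + t\<^sup>2)\<^sup>2 * sinc (a * t) ^ 4 \<le> 4 * 1"
        by (intro mult_mono) auto
      then show ?thesis by (simp add: C_def)
    next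
      case False
      then have t: "t \<noteq> 0" "1 \<le> t\<^sup>2"
        using one_le_power[of "\<bar>t\<bar>" 2] by auto
      then have "(1 + t\<^sup>2)\<^sup>2 \<le> (2 * t\<^sup>2)\<^sup>2" by (intro power_mono) auto
      then have sq: "(1 + t\<^sup>2)\<^sup>2 \<le> 4 * t ^ 4" by (simp add: power2_eq_square power4_eq_xxxx)
      have "sin (a * t) ^ 4 \<le> 1"
        using power_mono[OF abs_sin_le_one[of "a * t"], of 4] by simp
      then have "sinc (a * t) ^ 4 \<le> 1 / (a * t) ^ 4"
        using t a by (simp add: power_divide divide_right_mono)
      with sq have "(1 + t\<^sup>2)\<^sup>2 * sinc (a * t) ^ 4 \<le> (4 * t ^ 4) * (1 / (a * t) ^ 4)"
        by (intro mult_mono) auto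
      also have "\<dots> = 4 * (1 / a ^ 4)"
        using t a by (simp add: power_mult_distrib field_simps)
      finally show ?thesis by (simp add: C_def)
    qed
    then show ?thesis using pos by (simp add: pos_le_divide_eq power2_eq_square mult_ac)
  qed
  have "integrable lborel (\<lambda>t. C * (1 / (1 + t\<^sup>2)))"
    using integrable_inverse_1_plus_square by (rule integrable_mult_right)
  then show ?thesis
  proof (rule Bochner_Integration.integrable_bound)
    show "AE t in lborel. norm ((1 + t\<^sup>2) * sinc (a * t) ^ 4) \<le> norm (C * (1 / (1 + t\<^sup>2)))"
    proof (intro AE_I2)
      fix t
      have "0 \<le> (1 + t\<^sup>2) * sinc (a * t) ^ 4"
        by (intro mult_nonneg_nonneg zero_le_even_power) (auto simp: add_nonneg_nonneg)
      with bound[of t] show "norm ((1 + t\<^sup>2) * sinc (a * t) ^ 4) \<le> norm (C * (1 / (1 + t\<^sup>2)))"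
        unfolding real_norm_def by linarith
    qed
    show "(\<lambda>t. (1 + t\<^sup>2) * sinc (a * t) ^ 4) \<in> borel_measurable lborel"
      using measurable_compose[OF _ borel_measurable_sinc, of "\<lambda>t. a * t" lborel] by simp
  qed
qed

lemma kernel_fourier_integrable:
  assumes a: "a > 0"
  shows "integrable lborel (\<lambda>t. cis (z * t) * of_real (sinc (a * t) ^ 4))"
proof (rule Bochner_Integration.integrable_bound[OF integrable_sinc_4[OF a]])
  have "(\<lambda>t. sinc (a * t) ^ 4) \<in> borel_measurable lborel"
    using measurable_compose[OF _ borel_measurable_sinc, of "\<lambda>t. a * t" lborel] by simp
  moreover have "(\<lambda>t. cis (z * t)) \<in> borel_measurable lborel"
    unfolding cis_conv_exp by measurable
  ultimately show "(\<lambda>t. cis (z * t) * complex_of_real (sinc (a * t) ^ 4)) \<in> borel_measurable lborel"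
    by (intro borel_measurable_times measurable_compose[OF _ borel_measurable_of_real])
  show "AE t in lborel. norm (cis (z * t) * complex_of_real (sinc (a * t) ^ 4))
      \<le> norm ((1 + t\<^sup>2) * sinc (a * t) ^ 4)"
  proof (intro AE_I2)
    fix t
    have "1 * norm (sinc (a * t) ^ 4) \<le> norm (1 + t\<^sup>2) * norm (sinc (a * t) ^ 4)"
      by (intro mult_right_mono norm_ge_zero) simp
    then show "norm (cis (z * t) * complex_of_real (sinc (a * t) ^ 4))
        \<le> norm ((1 + t\<^sup>2) * sinc (a * t) ^ 4)"
      by (simp only: norm_mult mult_1 norm_cis norm_of_real real_norm_def)
  qed
qed

text \<open>Three factors \<open>sinc\<close> come from the characteristic function, the fourth from the inversion formula.\<close>

lemma kernel_fourier:
  assumes a: "a > 0"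
  shows "(\<integral>t. cis (z * t) * of_real (sinc (a * t) ^ 4) \<partial>lborel) = of_real (kernel a z)"
proof -
  interpret real_distribution "uniform_sum a 3"
    by (rule real_distribution_uniform_sum[OF a])
  have "s * s ^ 3 = s ^ 4" for s :: real
    by (simp add: eval_nat_numeral)
  then have ch: "of_real (sinc (a * t)) * char (uniform_sum a 3) t = of_real (sinc (a * t) ^ 4)" for t
    unfolding char_uniform_sum[OF a] by (simp only: of_real_mult[symmetric])
  have "integrable lborel (\<lambda>t. complex_of_real (sinc (a * t) ^ 4))"
    using kernel_fourier_integrable[OF a, of 0] by (simp only: mult_zero_left cis_zero mult_1)
  moreover have "emeasure (uniform_sum a 3) {x} = 0" for x
    using uniform_sum_atomless[OF a, of 2] by (simp only: numeral_3_eq_3 numeral_2_eq_2)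
  ultimately have "(\<integral>t. iexp (- (t * - z)) * of_real (sinc (a * t) ^ 4) \<partial>lborel) = of_real (kernel a z)"
    using sinc_char_inversion[OF a, of "- z"] unfolding ch kernel_def by (simp only:)
  then show ?thesis
    by (simp only: cis_conv_exp mult_minus_right minus_minus mult.commute[of z])
qed

section \<open>The regularising multiplier in several dimensions\<close>

text \<open>Fubini for functions that factorise over the coordinates.\<close>

lemma lborel_prod_Basis:
  fixes h :: "'a::euclidean_space \<Rightarrow> real \<Rightarrow> 'b::{real_normed_field, banach, second_countable_topology}"
  assumes "\<And>b. b \<in> Basis \<Longrightarrow> has_bochner_integral lborel (h b) (I b)"
  shows "has_bochner_integral lborel (\<lambda>x. \<Prod>b\<in>Basis. h b (x \<bullet> b)) (\<Prod>b\<in>Basis. I b)"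
proof -
  interpret product_sigma_finite "\<lambda>_::'a. lborel :: real measure" ..
  have int: "integrable lborel (h b)" and eq: "integral\<^sup>L lborel (h b) = I b" if "b \<in> Basis" for b
    using assms[OF that] by (auto simp: has_bochner_integral_iff)
  have [measurable]: "h b \<in> borel_measurable borel" if "b \<in> Basis" for b
    using int[OF that] by auto
  have meas: "(\<lambda>x. \<Prod>b\<in>Basis. h b (x \<bullet> b)) \<in> borel_measurable borel"
  proof (rule borel_measurable_prod)
    fix b :: 'a assume "b \<in> Basis"
    then have "h b \<in> borel_measurable borel" by measurable
    moreover have "(\<lambda>x. x \<bullet> b) \<in> borel_measurable borel" by simp
    ultimately show "(\<lambda>x. h b (x \<bullet> b)) \<in> borel_measurable borel"
      by (rule measurable_compose[rotated])
  qed
  have coord: "(\<lambda>f. \<Sum>b\<in>Basis. f b *\<^sub>R b) \<in> PiM (Basis :: 'a set) (\<lambda>_. lborel :: real measure) \<rightarrow>\<^sub>M borel"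
    by measurable
  have comp: "(\<Prod>b\<in>Basis. h b ((\<Sum>b'\<in>Basis. f b' *\<^sub>R b') \<bullet> b)) = (\<Prod>b\<in>Basis. h b (f b))" for f
    by (rule prod.cong) simp_all
  have "integrable (PiM Basis (\<lambda>_. lborel)) (\<lambda>f. \<Prod>b\<in>Basis. h b (f b))"
    by (rule product_integrable_prod) (auto intro: int)
  moreover have "(\<integral>f. (\<Prod>b\<in>Basis. h b (f b)) \<partial>PiM Basis (\<lambda>_. lborel)) = (\<Prod>b\<in>Basis. I b)"
    by (subst product_integral_prod) (auto intro: int simp: eq)
  ultimately have "integrable (distr (PiM Basis (\<lambda>_. lborel)) borel (\<lambda>f. \<Sum>b\<in>Basis. f b *\<^sub>R b))
      (\<lambda>x. \<Prod>b\<in>Basis. h b (x \<bullet> b))"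
    "(\<integral>x. (\<Prod>b\<in>Basis. h b (x \<bullet> b)) \<partial>distr (PiM Basis (\<lambda>_. lborel)) borel (\<lambda>f. \<Sum>b\<in>Basis. f b *\<^sub>R b))
      = (\<Prod>b\<in>Basis. I b)"
    by (simp_all only: integrable_distr_eq[OF coord meas] integral_distr[OF coord meas] comp)
  then show ?thesis
    by (simp only: has_bochner_integral_iff lborel_eq[symmetric])
qed

definition multiplier :: "real \<Rightarrow> 'a::euclidean_space \<Rightarrow> real"
  where "multiplier a \<xi> = (\<Prod>b\<in>Basis. sinc (a * (\<xi> \<bullet> b)) ^ 4)"

definition mollifier :: "real \<Rightarrow> 'a::euclidean_space \<Rightarrow> real"
  where "mollifier a z = (\<Prod>b\<in>Basis. kernel a (z \<bullet> b))"

lemma multiplier_nonneg: "0 \<le> multiplier a \<xi>"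
  unfolding multiplier_def by (intro prod_nonneg zero_le_even_power) simp

lemma multiplier_le_1: "multiplier a \<xi> \<le> 1"
  unfolding multiplier_def by (intro prod_le_1 conjI sinc_4_le_1 zero_le_even_power) simp

lemma measurable_multiplier [measurable]: "multiplier a \<in> borel_measurable borel"
  unfolding multiplier_def[abs_def]
  by (intro borel_measurable_prod borel_measurable_power measurable_compose[OF _ borel_measurable_sinc]) simp

lemma multiplier_tendsto: "((\<lambda>a. multiplier a \<xi>) \<longlongrightarrow> 1) (at_right 0)"
proof -
  have "((\<lambda>a. sinc (a * (\<xi> \<bullet> b)) ^ 4) \<longlongrightarrow> sinc (0 * (\<xi> \<bullet> b)) ^ 4) (at_right 0)" for b
    by (intro tendsto_power isCont_tendsto_compose[OF isCont_sinc] tendsto_intros)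
  then have "((\<lambda>a. \<Prod>b\<in>Basis. sinc (a * (\<xi> \<bullet> b)) ^ 4) \<longlongrightarrow> (\<Prod>b::'a\<in>Basis. sinc (0 * (\<xi> \<bullet> b)) ^ 4)) (at_right 0)"
    by (rule tendsto_prod)
  then show ?thesis by (simp add: multiplier_def)
qed

lemma one_plus_sum_le_prod:
  fixes x :: "'i \<Rightarrow> real"
  assumes "finite A" "\<And>i. i \<in> A \<Longrightarrow> 0 \<le> x i"
  shows "1 + sum x A \<le> (\<Prod>i\<in>A. 1 + x i)"
  using assms
proof induction
  case (insert j A)
  then have "0 \<le> sum x A" "0 \<le> x j" by (auto intro: sum_nonneg)
  then have "1 + sum x (insert j A) \<le> (1 + x j) * (1 + sum x A)"
    using insert.hyps by (simp add: algebra_simps)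
  also have "\<dots> \<le> (1 + x j) * (\<Prod>i\<in>A. 1 + x i)"
    using insert \<open>0 \<le> x j\<close> by (intro mult_left_mono) auto
  finally show ?case using insert.hyps by simp
qed simp

lemma abs_le_abs_of_nonneg: "0 \<le> x \<Longrightarrow> x \<le> y \<Longrightarrow> \<bar>x\<bar> \<le> \<bar>y\<bar>" for x y :: real
  by linarith

text \<open>
  The weight \<open>1 + (norm \<xi>)\<^sup>2\<close> is dominated by the product of the one-dimensional weights, which
  reduces the claim to one dimension.
\<close>

lemma integrable_multiplier:
  assumes a: "a > 0"
  shows "integrable lborel (\<lambda>\<xi>::'a::euclidean_space. (1 + (norm \<xi>)\<^sup>2) * multiplier a \<xi>)"
proof (rule Bochner_Integration.integrable_bound)
  show "integrable lborel (\<lambda>\<xi>::'a. \<Prod>b\<in>Basis. (1 + (\<xi> \<bullet> b)\<^sup>2) * sinc (a * (\<xi> \<bullet> b)) ^ 4)"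
    using lborel_prod_Basis[where 'a = 'a, OF has_bochner_integral_integrable[OF integrable_sinc_4[OF a]]]
    by (simp only: has_bochner_integral_iff)
  have "(1 + (norm \<xi>)\<^sup>2) * multiplier a \<xi> \<le> (\<Prod>b\<in>Basis. 1 + (\<xi> \<bullet> b)\<^sup>2) * multiplier a \<xi>" for \<xi> :: 'a
  proof (rule mult_right_mono[OF _ multiplier_nonneg])
    have "(norm \<xi>)\<^sup>2 = (\<Sum>b\<in>Basis. (\<xi> \<bullet> b)\<^sup>2)"
      unfolding power2_norm_eq_inner euclidean_inner[of \<xi> \<xi>] by (simp only: power2_eq_square)
    then show "1 + (norm \<xi>)\<^sup>2 \<le> (\<Prod>b\<in>Basis. 1 + (\<xi> \<bullet> b)\<^sup>2)"
      using one_plus_sum_le_prod[of Basis "\<lambda>b. (\<xi> \<bullet> b)\<^sup>2"] by (simp only: finite_Basis zero_le_power2 simp_thms)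
  qed
  then have "(1 + (norm \<xi>)\<^sup>2) * multiplier a \<xi>
      \<le> (\<Prod>b\<in>Basis. (1 + (\<xi> \<bullet> b)\<^sup>2) * sinc (a * (\<xi> \<bullet> b)) ^ 4)" for \<xi> :: 'a
    by (simp only: prod.distrib multiplier_def)
  moreover have "0 \<le> (1 + (norm \<xi>)\<^sup>2) * multiplier a \<xi>" for \<xi> :: 'a
    by (intro mult_nonneg_nonneg multiplier_nonneg) simp
  ultimately show "AE \<xi>::'a in lborel. norm ((1 + (norm \<xi>)\<^sup>2) * multiplier a \<xi>)
      \<le> norm (\<Prod>b\<in>Basis. (1 + (\<xi> \<bullet> b)\<^sup>2) * sinc (a * (\<xi> \<bullet> b)) ^ 4)"
    unfolding real_norm_def by (intro AE_I2) (rule abs_le_abs_of_nonneg)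
  have "(\<lambda>\<xi>::'a. 1 + (norm \<xi>)\<^sup>2) \<in> borel_measurable lborel" by simp
  then show "(\<lambda>\<xi>::'a. (1 + (norm \<xi>)\<^sup>2) * multiplier a \<xi>) \<in> borel_measurable lborel"
    using measurable_multiplier by (intro borel_measurable_times) auto
qed

lemma mollifier_fourier:
  fixes z :: "'a::euclidean_space"
  assumes a: "a > 0"
  shows "(\<integral>\<xi>. cis (z \<bullet> \<xi>) * of_real (multiplier a \<xi>) \<partial>lborel) = of_real (mollifier a z)"
proof -
  let ?h = "\<lambda>b t. cis ((z \<bullet> b) * t) * complex_of_real (sinc (a * t) ^ 4)"
  have "has_bochner_integral lborel (?h b) (of_real (kernel a (z \<bullet> b)))" for b :: 'a
    unfolding has_bochner_integral_iff
    using kernel_fourier[OF a, of "z \<bullet> b"] kernel_fourier_integrable[OF a, of "z \<bullet> b"] by blast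
  from lborel_prod_Basis[of ?h, OF this]
  have "(\<integral>\<xi>. (\<Prod>b\<in>Basis. ?h b (\<xi> \<bullet> b)) \<partial>lborel) = (\<Prod>b\<in>Basis. of_real (kernel a (z \<bullet> b)))"
    by (simp only: has_bochner_integral_iff)
  moreover have "(\<Prod>b\<in>Basis. ?h b (\<xi> \<bullet> b)) = cis (z \<bullet> \<xi>) * of_real (multiplier a \<xi>)" for \<xi>
  proof -
    have "(\<Prod>b\<in>Basis. cis ((z \<bullet> b) * (\<xi> \<bullet> b))) = cis (z \<bullet> \<xi>)"
      by (simp add: cis_conv_exp euclidean_inner[of z \<xi>] sum_distrib_left flip: exp_sum)
    then show ?thesis by (simp only: prod.distrib multiplier_def of_real_prod)
  qed
  ultimately show ?thesis by (simp add: mollifier_def)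
qed

lemma mollifier_nonneg: "a > 0 \<Longrightarrow> 0 \<le> mollifier a z"
  unfolding mollifier_def by (intro prod_nonneg kernel_nonneg)

text \<open>
  A vector of large norm has a large coordinate; the factor \<open>DIM('a)\<close> is the crude comparison of the
  Euclidean norm with the sum of the coordinates.
\<close>

lemma mollifier_eq_0:
  fixes z :: "'a::euclidean_space" and a :: real
  assumes a: "a > 0" and z: "norm z > 4 * a * DIM('a)"
  shows "mollifier a z = 0"
proof -
  have "\<exists>b\<in>Basis. \<bar>z \<bullet> b\<bar> > 4 * a"
  proof (rule ccontr)
    assume "\<not> ?thesis"
    then have "(\<Sum>b\<in>Basis. \<bar>z \<bullet> b\<bar>) \<le> real (DIM('a)) * (4 * a)"
      by (intro sum_bounded_above) (auto simp: not_less)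
    with norm_le_l1[of z] z show False by (simp add: mult_ac)
  qed
  then obtain b where b: "b \<in> Basis" "\<bar>z \<bullet> b\<bar> > 4 * a" by blast
  have "\<exists>b\<in>Basis. kernel a (z \<bullet> b) = 0"
    using kernel_eq_0[OF a b(2)] b(1) by blast
  then show ?thesis
    unfolding mollifier_def by (intro prod_zero finite_Basis)
qed

lemma mollifier_integral:
  fixes z :: "'a::euclidean_space"
  assumes a: "a > 0"
  shows "has_bochner_integral lborel (\<lambda>u. mollifier a (z - u)) ((2 * pi) ^ DIM('a))"
proof -
  have "has_bochner_integral lborel (\<lambda>t. kernel a (z \<bullet> b + (-1) * t)) (2 * pi)" for b
    using lborel_has_bochner_integral_real_affine_iff[of "-1" "kernel a" "2 * pi" "z \<bullet> b"] kernel_integral[OF a]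
    by simp
  from lborel_prod_Basis[OF this]
  show ?thesis
    by (simp add: mollifier_def inner_diff_left)
qed

lemma measurable_cis [measurable]: "cis \<in> borel_measurable borel"
  unfolding cis_conv_exp[abs_def] by measurable

lemma fourier_measurable:
  fixes f :: "real^'d \<Rightarrow> real"
  assumes [measurable]: "f \<in> borel_measurable borel"
  shows "fourier f \<in> borel_measurable borel"
proof -
  have "(\<lambda>(\<xi>, x). cis (- (x \<bullet> \<xi>)) * complex_of_real (f x))
      \<in> borel_measurable (borel \<Otimes>\<^sub>M (lborel :: (real^'d) measure))"
    unfolding case_prod_beta by measurable
  from lborel.borel_measurable_lebesgue_integral[OF this]
  show ?thesis
    unfolding fourier_def[abs_def] by (intro borel_measurable_scaleR) auto
qed

text \<open>A crude bound suffices, because the multiplier supplies the decay.\<close>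

lemma norm_fourier_le:
  fixes \<xi> :: "real^'d"
  assumes "integrable lborel f"
  shows "cmod (fourier f \<xi>) \<le> (2 * pi) powr (- real CARD('d) / 2) * (\<integral>x. \<bar>f x\<bar> \<partial>lborel)"
proof -
  have "cmod (\<integral>x. cis (- (x \<bullet> \<xi>)) * complex_of_real (f x) \<partial>lborel) \<le> (\<integral>x. \<bar>f x\<bar> \<partial>lborel)"
    by (rule order_trans[OF integral_norm_bound]) (simp add: norm_mult)
  then show ?thesis
    unfolding fourier_def by (simp add: mult_left_mono)
qed

lemma mollified_fourier_integrable:
  fixes f :: "real^'d \<Rightarrow> real"
  assumes a: "a > 0" and f: "integrable lborel f"
  shows "integrable lborel
    (\<lambda>\<xi>. (1 + (norm \<xi>)\<^sup>2) * cmod (cis (x \<bullet> \<xi>) * of_real (multiplier a \<xi>) * fourier f \<xi>))"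
proof (rule Bochner_Integration.integrable_bound)
  let ?C = "(2 * pi) powr (- real CARD('d) / 2) * (\<integral>x. \<bar>f x\<bar> \<partial>lborel)"
  show "integrable lborel (\<lambda>\<xi>::real^'d. (1 + (norm \<xi>)\<^sup>2) * multiplier a \<xi> * ?C)"
    by (rule integrable_mult_left) (rule integrable_multiplier[OF a])
  have [measurable]: "fourier f \<in> borel_measurable borel"
    using f by (intro fourier_measurable) auto
  show "(\<lambda>\<xi>. (1 + (norm \<xi>)\<^sup>2) * cmod (cis (x \<bullet> \<xi>) * of_real (multiplier a \<xi>) * fourier f \<xi>))
      \<in> borel_measurable lborel"
    by measurable
  show "AE \<xi> in lborel.
      norm ((1 + (norm \<xi>)\<^sup>2) * cmod (cis (x \<bullet> \<xi>) * of_real (multiplier a \<xi>) * fourier f \<xi>))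
      \<le> norm ((1 + (norm \<xi>)\<^sup>2) * multiplier a \<xi> * ?C)"
  proof (rule AE_I2)
    fix \<xi> :: "real^'d"
    have "(1 + (norm \<xi>)\<^sup>2) * (multiplier a \<xi> * cmod (fourier f \<xi>))
        \<le> (1 + (norm \<xi>)\<^sup>2) * (multiplier a \<xi> * ?C)"
      by (intro mult_left_mono norm_fourier_le f multiplier_nonneg) simp
    moreover have "cmod (cis (x \<bullet> \<xi>) * of_real (multiplier a \<xi>) * fourier f \<xi>)
        = multiplier a \<xi> * cmod (fourier f \<xi>)"
      by (simp add: norm_mult multiplier_nonneg)
    moreover have "0 \<le> (1 + (norm \<xi>)\<^sup>2) * (multiplier a \<xi> * cmod (fourier f \<xi>))"
      by (intro mult_nonneg_nonneg multiplier_nonneg) auto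
    ultimately show "norm ((1 + (norm \<xi>)\<^sup>2) * cmod (cis (x \<bullet> \<xi>) * of_real (multiplier a \<xi>) * fourier f \<xi>))
      \<le> norm ((1 + (norm \<xi>)\<^sup>2) * multiplier a \<xi> * ?C)"
      by (simp only: real_norm_def mult.assoc)
  qed
qed

text \<open>
  Inversion with a regularising multiplier needs only Fubini, since the multiplier has an explicit
  integrable inverse transform: the result is the convolution of \<open>f\<close> with the mollifier.
\<close>

lemma mollified_fourier_inversion:
  fixes f :: "real^'d \<Rightarrow> real"
  assumes a: "a > 0" and f: "integrable lborel f"
  shows "(\<integral>\<xi>. cis (z \<bullet> \<xi>) * of_real (multiplier a \<xi>) * fourier f \<xi> \<partial>lborel)
    = of_real ((2 * pi) powr (- real CARD('d) / 2) * (\<integral>u. f u * mollifier a (z - u) \<partial>lborel))"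
proof -
  let ?c = "(2 * pi) powr (- real CARD('d) / 2)"
  let ?H = "\<lambda>\<xi> u. cis (z \<bullet> \<xi>) * of_real (multiplier a \<xi>) * (cis (- (u \<bullet> \<xi>)) * complex_of_real (f u))"
  have [measurable]: "f \<in> borel_measurable borel" using f by auto
  have normH: "norm (?H \<xi> u) = multiplier a \<xi> * \<bar>f u\<bar>" for \<xi> u
    by (simp add: norm_mult multiplier_nonneg)
  have m: "integrable lborel (\<lambda>\<xi>::real^'d. multiplier a \<xi>)"
  proof (rule Bochner_Integration.integrable_bound[OF integrable_multiplier[OF a]])
    show "AE \<xi>::real^'d in lborel. norm (multiplier a \<xi>) \<le> norm ((1 + (norm \<xi>)\<^sup>2) * multiplier a \<xi>)"
      using multiplier_nonneg[of a] by (intro AE_I2) (simp add: abs_mult mult_le_cancel_right1)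
  qed simp
  have int: "integrable (lborel \<Otimes>\<^sub>M lborel) (\<lambda>(\<xi>, u). ?H \<xi> u)"
  proof (rule lborel_pair.Fubini_integrable)
    show "(\<lambda>(\<xi>, u). ?H \<xi> u) \<in> borel_measurable (lborel \<Otimes>\<^sub>M lborel)"
      unfolding case_prod_beta by measurable
    show "integrable lborel (\<lambda>\<xi>. \<integral>u. norm (case (\<xi>, u) of (\<xi>, u) \<Rightarrow> ?H \<xi> u) \<partial>lborel)"
      unfolding prod.case normH using m by simp
    show "AE \<xi> in lborel. integrable lborel (\<lambda>u. case (\<xi>, u) of (\<xi>, u) \<Rightarrow> ?H \<xi> u)"
    proof (rule AE_I2)
      fix \<xi> :: "real^'d"
      show "integrable lborel (\<lambda>u. case (\<xi>, u) of (\<xi>, u) \<Rightarrow> ?H \<xi> u)"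
        unfolding prod.case
      proof (rule Bochner_Integration.integrable_bound)
        show "integrable lborel (\<lambda>u. multiplier a \<xi> * \<bar>f u\<bar>)" using f by simp
        show "(\<lambda>u. ?H \<xi> u) \<in> borel_measurable lborel" by measurable
      qed (simp add: norm_mult)
    qed
  qed
  have inner: "(\<integral>\<xi>. ?H \<xi> u \<partial>lborel) = of_real (f u * mollifier a (z - u))" for u
  proof -
    have "?H \<xi> u = of_real (f u) * (cis ((z - u) \<bullet> \<xi>) * of_real (multiplier a \<xi>))" for \<xi>
    proof -
      have "cis ((z - u) \<bullet> \<xi>) = cis (z \<bullet> \<xi>) * cis (- (u \<bullet> \<xi>))"
        by (simp add: cis_mult inner_diff_left)
      then show ?thesis by (simp only: mult_ac)
    qed
    then have "(\<integral>\<xi>. ?H \<xi> u \<partial>lborel) = of_real (f u) * (\<integral>\<xi>. cis ((z - u) \<bullet> \<xi>) * of_real (multiplier a \<xi>) \<partial>lborel)"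
      by (simp only: integral_mult_right_zero)
    then show ?thesis by (simp add: mollifier_fourier[OF a])
  qed
  have "(\<integral>\<xi>. cis (z \<bullet> \<xi>) * of_real (multiplier a \<xi>) * fourier f \<xi> \<partial>lborel)
      = (\<integral>\<xi>. ?c *\<^sub>R (\<integral>u. ?H \<xi> u \<partial>lborel) \<partial>lborel)"
    unfolding fourier_def by (simp only: mult_scaleR_right integral_mult_right_zero)
  also have "\<dots> = ?c *\<^sub>R (\<integral>u. (\<integral>\<xi>. ?H \<xi> u \<partial>lborel) \<partial>lborel)"
    by (simp only: integral_scaleR_right lborel_pair.Fubini_integral[OF int])
  also have "\<dots> = of_real (?c * (\<integral>u. f u * mollifier a (z - u) \<partial>lborel))"
    unfolding inner integral_complex_of_real scaleR_conv_of_real by (rule of_real_mult[symmetric])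
  finally show ?thesis .
qed

section \<open>Levy-Khintchine symbols tested away from the base point\<close>

text \<open>
  Where \<open>min 1 ((norm y)\<^sup>2)\<close> is at least \<open>1 / n\<close>, Markov's inequality bounds the mass; these sets
  exhaust everything except the origin, which is a null set. Sigma-finiteness is what Fubini asks for.
\<close>

lemma levy_measure_sigma_finite:
  assumes "levy_measure N"
  shows "sigma_finite_measure N"
proof -
  have sets [measurable_cong]: "sets N = sets borel" and space: "space N = UNIV"
    and fin: "(\<integral>\<^sup>+y. ennreal (min 1 ((norm y)\<^sup>2)) \<partial>N) < \<infinity>" and zero: "emeasure N {0} = 0"
    using assms by (auto simp: levy_measure_def dest: sets_eq_imp_space_eq)
  define A where "A n = {y \<in> space N. 1 \<le> ennreal (real (Suc n)) * ennreal (min 1 ((norm y)\<^sup>2))}" for n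
  have "emeasure N (A n) < \<infinity>" for n
  proof -
    have "emeasure N (A n) \<le> ennreal (real (Suc n)) * (\<integral>\<^sup>+y. ennreal (min 1 ((norm y)\<^sup>2)) * indicator (space N) y \<partial>N)"
      unfolding A_def by (intro nn_integral_Markov_inequality) auto
    also have "\<dots> = ennreal (real (Suc n)) * (\<integral>\<^sup>+y. ennreal (min 1 ((norm y)\<^sup>2)) \<partial>N)"
      by (intro arg_cong2[where f = "(*)"] refl nn_integral_cong) simp
    also have "\<dots> < \<infinity>" using fin by (simp add: ennreal_mult_less_top)
    finally show ?thesis .
  qed
  moreover have "y \<in> {0} \<union> (\<Union>n. A n)" for y
  proof (cases "y = 0")
    case False
    then have "0 < min 1 ((norm y)\<^sup>2)" by simp
    then obtain n where "inverse (real (Suc n)) < min 1 ((norm y)\<^sup>2)"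
      using reals_Archimedean by blast
    then have "real (Suc n) * inverse (real (Suc n)) \<le> real (Suc n) * min 1 ((norm y)\<^sup>2)"
      by (intro mult_left_mono) auto
    then have "1 \<le> real (Suc n) * min 1 ((norm y)\<^sup>2)"
      by (subst (asm) right_inverse) auto
    then have "1 \<le> ennreal (real (Suc n)) * ennreal (min 1 ((norm y)\<^sup>2))"
      by (simp add: ennreal_mult'[symmetric] del: of_nat_Suc)
    then show ?thesis by (auto simp: A_def space)
  qed simp
  moreover have "A n \<in> sets N" for n unfolding A_def by measurable
  ultimately show ?thesis
    using zero by unfold_locales
      (auto intro!: exI[of _ "insert {0} (range A)"] simp: sets space less_top[symmetric])
qed

definition levy_integrand :: "'a::euclidean_space \<Rightarrow> 'a \<Rightarrow> complex"
  where "levy_integrand \<xi> y = cis (\<xi> \<bullet> y) - 1 - \<i> * of_real ((\<xi> \<bullet> y) * chi y)"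

lemma cmod_cis_minus_1_minus_le: "cmod (cis t - 1 - \<i> * of_real t) \<le> t\<^sup>2 / 2"
  using iexp_approx1[of t 1] by (simp add: cis_conv_exp diff_diff_eq numeral_2_eq_2)

text \<open>
  Below norm one the compensated exponential is a second-order Taylor remainder; above, the
  compensator is absent and the exponential is bounded.
\<close>

lemma norm_levy_integrand_le:
  "cmod (levy_integrand \<xi> y) \<le> 2 * (1 + (norm \<xi>)\<^sup>2) * min 1 ((norm y)\<^sup>2)"
proof (cases "norm y < 1")
  case True
  have "cmod (levy_integrand \<xi> y) \<le> (\<xi> \<bullet> y)\<^sup>2 / 2"
  proof (cases "y = 0")
    case False
    then have "chi y = 1" using True by (simp add: chi_def)
    then show ?thesis using cmod_cis_minus_1_minus_le[of "\<xi> \<bullet> y"] by (simp add: levy_integrand_def)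
  qed (simp add: levy_integrand_def)
  also have "(\<xi> \<bullet> y)\<^sup>2 \<le> (norm \<xi> * norm y)\<^sup>2"
    by (metis Cauchy_Schwarz_ineq2 abs_ge_zero power2_abs power_mono)
  then have "(\<xi> \<bullet> y)\<^sup>2 / 2 \<le> 2 * (1 + (norm \<xi>)\<^sup>2) * (norm y)\<^sup>2"
    by (simp add: power_mult_distrib algebra_simps) (smt (verit) mult_nonneg_nonneg zero_le_power2)
  also have "(norm y)\<^sup>2 = min 1 ((norm y)\<^sup>2)"
    using True power_le_one[of "norm y" 2] by (simp add: min_absorb2)
  finally show ?thesis .
next
  case False
  then have "chi y = 0" "1 \<le> (norm y)\<^sup>2" by (auto simp: chi_def)
  moreover have "cmod (cis (\<xi> \<bullet> y) - 1) \<le> 2"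
    using norm_triangle_ineq4[of "cis (\<xi> \<bullet> y)" 1] by simp
  ultimately show ?thesis
    by (simp add: levy_integrand_def) (smt (verit) zero_le_power2)
qed

lemma levy_khintchine_pure_jump:
  fixes b \<xi> :: "real^'d"
  shows
  "levy_khintchine b 0 N \<xi> = \<i> * of_real (b \<bullet> \<xi>) + (\<integral>y. levy_integrand \<xi> y \<partial>N)"
proof -
  have "(\<integral>y\<in>- {0}. (cis (\<xi> \<bullet> y) - 1 - \<i> * of_real ((\<xi> \<bullet> y) * chi y)) \<partial>N) = (\<integral>y. levy_integrand \<xi> y \<partial>N)"
    unfolding set_lebesgue_integral_def
    by (intro Bochner_Integration.integral_cong) (auto simp: levy_integrand_def indicator_def)
  moreover have "(0::real^'d^'d) *v \<xi> = 0"
    by (simp add: matrix_vector_mult_def vec_eq_iff)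
  ultimately show ?thesis by (simp add: levy_khintchine_def)
qed

lemma cis_difference_quotient:
  "((\<lambda>t. (cis (t * k) - 1) / of_real t) \<longlongrightarrow> \<i> * of_real k) (at 0)"
proof (rule Lim_null[THEN iffD2], rule Lim_null_comparison)
  show "\<forall>\<^sub>F t in at 0. norm ((cis (t * k) - 1) / of_real t - \<i> * of_real k) \<le> \<bar>t\<bar> * (k\<^sup>2 / 2)"
  proof (rule eventually_at_filter[THEN iffD2], intro always_eventually allI impI)
    fix t :: real assume t: "t \<noteq> 0"
    have "(cis (t * k) - 1) / of_real t - \<i> * of_real k = (cis (t * k) - 1 - \<i> * of_real (t * k)) / of_real t"
      using t by (simp add: field_simps)
    then have "norm ((cis (t * k) - 1) / of_real t - \<i> * of_real k)
        = cmod (cis (t * k) - 1 - \<i> * of_real (t * k)) / \<bar>t\<bar>"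
      by (simp only: norm_divide norm_of_real)
    also have "\<dots> \<le> ((t * k)\<^sup>2 / 2) / \<bar>t\<bar>"
      by (intro divide_right_mono cmod_cis_minus_1_minus_le) simp
    also have "\<dots> = \<bar>t\<bar> * (k\<^sup>2 / 2)"
      using t by (simp add: power_mult_distrib power2_eq_square abs_if)
    finally show "norm ((cis (t * k) - 1) / of_real t - \<i> * of_real k) \<le> \<bar>t\<bar> * (k\<^sup>2 / 2)" .
  qed
  show "((\<lambda>t. \<bar>t\<bar> * (k\<^sup>2 / 2)) \<longlongrightarrow> 0) (at (0::real))"
  proof -
    have "((\<lambda>t. \<bar>t\<bar> * (k\<^sup>2 / 2)) \<longlongrightarrow> \<bar>0\<bar> * (k\<^sup>2 / 2)) (at (0::real))"
      by (intro tendsto_mult tendsto_rabs tendsto_ident_at tendsto_const)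
    then show ?thesis by simp
  qed
qed

text \<open>
  The assumption says that the function \<open>v \<mapsto> \<integral> w(\<xi>) cis (\<xi> \<bullet> v) d\<xi>\<close> vanishes near the origin; the
  conclusion is that its directional derivatives at the origin vanish, computed by
  differentiation under the integral sign.
\<close>

lemma gradient_zero:
  fixes w :: "'a::euclidean_space \<Rightarrow> complex"
  assumes [measurable]: "w \<in> borel_measurable borel"
    and w: "integrable lborel (\<lambda>\<xi>. (1 + (norm \<xi>)\<^sup>2) * cmod (w \<xi>))"
    and \<eta>: "\<eta> > 0" and zero: "\<And>v. norm v < \<eta> \<Longrightarrow> (\<integral>\<xi>. w \<xi> * cis (\<xi> \<bullet> v) \<partial>lborel) = 0"
  shows "integrable lborel (\<lambda>\<xi>. w \<xi> * (\<i> * of_real (\<xi> \<bullet> v)))"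
    and "(\<integral>\<xi>. w \<xi> * (\<i> * of_real (\<xi> \<bullet> v)) \<partial>lborel) = 0"
proof -
  have w0: "integrable lborel w"
  proof (rule Bochner_Integration.integrable_bound[OF w])
    show "AE \<xi> in lborel. norm (w \<xi>) \<le> norm ((1 + (norm \<xi>)\<^sup>2) * cmod (w \<xi>))"
      by (intro AE_I2) (simp add: abs_mult mult_le_cancel_right1)
  qed simp
  have le: "\<bar>\<xi> \<bullet> v\<bar> * cmod (w \<xi>) \<le> norm v * ((1 + (norm \<xi>)\<^sup>2) * cmod (w \<xi>))" for \<xi>
  proof -
    have "0 \<le> (norm \<xi> - 1)\<^sup>2" by simp
    then have "2 * norm \<xi> \<le> (norm \<xi>)\<^sup>2 + 1"
      unfolding power2_diff by simp
    then have "norm \<xi> \<le> 1 + (norm \<xi>)\<^sup>2"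
      using norm_ge_zero[of \<xi>] by linarith
    have "\<bar>\<xi> \<bullet> v\<bar> \<le> norm \<xi> * norm v" by (rule Cauchy_Schwarz_ineq2)
    also have "\<dots> \<le> (1 + (norm \<xi>)\<^sup>2) * norm v"
      using \<open>norm \<xi> \<le> 1 + (norm \<xi>)\<^sup>2\<close> by (rule mult_right_mono) simp
    finally have "\<bar>\<xi> \<bullet> v\<bar> * cmod (w \<xi>) \<le> (1 + (norm \<xi>)\<^sup>2) * norm v * cmod (w \<xi>)"
      by (rule mult_right_mono) simp
    then show ?thesis by (simp only: mult_ac)
  qed
  \<comment> \<open>Nonzero step sizes that tend to zero and keep \<open>\<tau> n *\<^sub>R v\<close> in the ball where the transform vanishes; \<open>1 + norm v\<close> covers \<open>v = 0\<close>.\<close>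
  define \<tau> where "\<tau> n = \<eta> / (1 + norm v) * inverse (real (Suc n))" for n
  have pos: "\<tau> n > 0" for n
    unfolding \<tau>_def using \<eta> by (intro mult_pos_pos divide_pos_pos) (auto simp: add_pos_nonneg)
  have small: "norm (\<tau> n *\<^sub>R v) < \<eta>" for n
  proof -
    have "inverse (real (Suc n)) \<le> 1" by (simp add: inverse_le_1_iff)
    then have "\<tau> n \<le> \<eta> / (1 + norm v)"
      unfolding \<tau>_def using \<eta> by (intro mult_left_le) auto
    then have "\<tau> n * (1 + norm v) \<le> \<eta>"
      by (simp add: pos_le_divide_eq add_pos_nonneg)
    then show ?thesis using pos[of n] by (simp add: algebra_simps)
  qed
  have "\<tau> \<longlonglongrightarrow> \<eta> / (1 + norm v) * 0"
    unfolding \<tau>_def[abs_def] by (intro tendsto_mult tendsto_const LIMSEQ_inverse_real_of_nat)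
  then have \<tau>: "filterlim \<tau> (at 0) sequentially"
    using pos by (intro filterlim_atI) (auto intro!: always_eventually simp: less_imp_neq[symmetric])
  let ?s = "\<lambda>n \<xi>. w \<xi> * ((cis (\<tau> n * (\<xi> \<bullet> v)) - 1) / of_real (\<tau> n))"
  let ?g = "\<lambda>\<xi>. w \<xi> * (\<i> * of_real (\<xi> \<bullet> v))"
  have dom: "integrable lborel (\<lambda>\<xi>. norm v * ((1 + (norm \<xi>)\<^sup>2) * cmod (w \<xi>)))"
    using w by (rule integrable_mult_right)
  have lim: "AE \<xi> in lborel. (\<lambda>n. ?s n \<xi>) \<longlonglongrightarrow> ?g \<xi>"
    by (intro AE_I2 tendsto_mult tendsto_const filterlim_compose[OF cis_difference_quotient \<tau>])
  have bound: "AE \<xi> in lborel. norm (?s n \<xi>) \<le> norm v * ((1 + (norm \<xi>)\<^sup>2) * cmod (w \<xi>))" for n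
  proof (intro AE_I2)
    fix \<xi>
    have "cmod (cis (\<tau> n * (\<xi> \<bullet> v)) - 1) \<le> \<bar>\<tau> n * (\<xi> \<bullet> v)\<bar>"
      using iexp_approx1[of "\<tau> n * (\<xi> \<bullet> v)" 0] by (simp add: cis_conv_exp)
    then have "cmod ((cis (\<tau> n * (\<xi> \<bullet> v)) - 1) / of_real (\<tau> n)) \<le> \<bar>\<xi> \<bullet> v\<bar>"
      using pos[of n] by (simp add: norm_divide abs_mult pos_divide_le_eq mult.commute)
    then have "cmod (w \<xi>) * cmod ((cis (\<tau> n * (\<xi> \<bullet> v)) - 1) / of_real (\<tau> n)) \<le> cmod (w \<xi>) * \<bar>\<xi> \<bullet> v\<bar>"
      by (rule mult_left_mono) simp
    with le[of \<xi>] show "norm (?s n \<xi>) \<le> norm v * ((1 + (norm \<xi>)\<^sup>2) * cmod (w \<xi>))"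
      unfolding norm_mult by (simp only: mult.commute[of "cmod (w \<xi>)" "\<bar>\<xi> \<bullet> v\<bar>"] order_trans)
  qed
  have ms: "?s n \<in> borel_measurable lborel" for n by measurable
  have mg: "?g \<in> borel_measurable lborel" by measurable
  show "integrable lborel ?g"
    by (rule integrable_dominated_convergence[OF mg ms dom lim bound])
  have "(\<lambda>n. \<integral>\<xi>. ?s n \<xi> \<partial>lborel) \<longlonglongrightarrow> (\<integral>\<xi>. ?g \<xi> \<partial>lborel)"
    by (rule integral_dominated_convergence[OF mg ms dom lim bound])
  moreover have "(\<integral>\<xi>. ?s n \<xi> \<partial>lborel) = 0" for n
  proof -
    have iw: "integrable lborel (\<lambda>\<xi>. w \<xi> * cis (\<xi> \<bullet> u))" for u
      by (rule Bochner_Integration.integrable_bound[OF w0]) (auto simp: norm_mult)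
    have "?s n \<xi> = (w \<xi> * cis (\<xi> \<bullet> (\<tau> n *\<^sub>R v)) - w \<xi> * cis (\<xi> \<bullet> 0)) / of_real (\<tau> n)" for \<xi>
      by (simp add: right_diff_distrib)
    then have "(\<integral>\<xi>. ?s n \<xi> \<partial>lborel)
        = ((\<integral>\<xi>. w \<xi> * cis (\<xi> \<bullet> (\<tau> n *\<^sub>R v)) \<partial>lborel) - (\<integral>\<xi>. w \<xi> * cis (\<xi> \<bullet> 0) \<partial>lborel)) / of_real (\<tau> n)"
      using iw by (simp only: integral_divide_zero Bochner_Integration.integral_diff)
    then show ?thesis using zero[OF small] zero[of 0] \<eta> by (simp only: norm_zero) simp
  qed
  ultimately show "(\<integral>\<xi>. ?g \<xi> \<partial>lborel) = 0"
    by (simp only: LIMSEQ_const_iff)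
qed

text \<open>
  Integrating the Levy-Khintchine integrand against \<open>w\<close> gives the value at \<open>y\<close> of the inverse
  transform of \<open>w\<close>, minus its value at the origin, minus a multiple of its derivative at the origin.
  If the inverse transform vanishes near the origin, only the first term survives, and the drift
  disappears for the same reason.
\<close>

lemma levy_khintchine_fubini:
  fixes w :: "real^'d \<Rightarrow> complex"
  assumes N: "levy_measure N" and [measurable]: "w \<in> borel_measurable borel"
    and w: "integrable lborel (\<lambda>\<xi>. (1 + (norm \<xi>)\<^sup>2) * cmod (w \<xi>))"
    and \<eta>: "\<eta> > 0" and zero: "\<And>v. norm v < \<eta> \<Longrightarrow> (\<integral>\<xi>. w \<xi> * cis (\<xi> \<bullet> v) \<partial>lborel) = 0"
  shows "integrable N (\<lambda>y. \<integral>\<xi>. w \<xi> * cis (\<xi> \<bullet> y) \<partial>lborel)"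
    and "(\<integral>\<xi>. w \<xi> * levy_khintchine b 0 N \<xi> \<partial>lborel)
      = (\<integral>y. (\<integral>\<xi>. w \<xi> * cis (\<xi> \<bullet> y) \<partial>lborel) \<partial>N)"
proof -
  have sets [measurable_cong]: "sets N = sets borel"
    and fin: "(\<integral>\<^sup>+y. ennreal (min 1 ((norm y)\<^sup>2)) \<partial>N) < \<infinity>"
    using N by (auto simp: levy_measure_def)
  interpret N: sigma_finite_measure N by (rule levy_measure_sigma_finite[OF N])
  interpret L: pair_sigma_finite lborel N ..
  have mN: "integrable N (\<lambda>y. min 1 ((norm y)\<^sup>2))"
    by (rule integrableI_nonneg) (use fin in auto)
  let ?H = "\<lambda>\<xi> y. w \<xi> * levy_integrand \<xi> y"
  let ?B = "\<lambda>\<xi> y. 2 * (1 + (norm \<xi>)\<^sup>2) * cmod (w \<xi>) * min 1 ((norm y)\<^sup>2)"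
  have chi_meas: "(chi :: real^'d \<Rightarrow> real) \<in> borel_measurable borel"
    unfolding chi_def[abs_def] by measurable
  have mH: "(\<lambda>(\<xi>, y). ?H \<xi> y) \<in> borel_measurable (lborel \<Otimes>\<^sub>M N)"
    using chi_meas unfolding levy_integrand_def case_prod_beta by measurable
  have B: "integrable (lborel \<Otimes>\<^sub>M N) (\<lambda>(\<xi>, y). ?B \<xi> y)"
  proof (rule L.Fubini_integrable)
    show "(\<lambda>(\<xi>, y). ?B \<xi> y) \<in> borel_measurable (lborel \<Otimes>\<^sub>M N)"
      unfolding case_prod_beta by measurable
    have "norm (?B \<xi> y) = (1 + (norm \<xi>)\<^sup>2) * cmod (w \<xi>) * (2 * min 1 ((norm y)\<^sup>2))" for \<xi> y :: "real^'d"
      by (simp add: abs_mult mult_ac)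
    then have "(\<integral>y. norm (?B \<xi> y) \<partial>N) = (1 + (norm \<xi>)\<^sup>2) * cmod (w \<xi>) * (\<integral>y. 2 * min 1 ((norm y)\<^sup>2) \<partial>N)" for \<xi>
      by (simp only: integral_mult_right_zero)
    then show "integrable lborel (\<lambda>\<xi>. \<integral>y. norm (case (\<xi>, y) of (\<xi>, y) \<Rightarrow> ?B \<xi> y) \<partial>N)"
      using w by (simp only: prod.case) (rule integrable_mult_left)
    show "AE \<xi> in lborel. integrable N (\<lambda>y. case (\<xi>, y) of (\<xi>, y) \<Rightarrow> ?B \<xi> y)"
      unfolding prod.case by (intro AE_I2 integrable_mult_right mN)
  qed
  have bound: "norm (?H \<xi> y) \<le> ?B \<xi> y" for \<xi> y
    using mult_left_mono[OF norm_levy_integrand_le[of \<xi> y] norm_ge_zero[of "w \<xi>"]]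
    unfolding norm_mult by (simp only: mult_ac)
  have H: "integrable (lborel \<Otimes>\<^sub>M N) (\<lambda>(\<xi>, y). ?H \<xi> y)"
  proof (rule Bochner_Integration.integrable_bound[OF B mH], rule AE_I2)
    fix p :: "(real^'d) \<times> (real^'d)"
    show "norm (case p of (\<xi>, y) \<Rightarrow> ?H \<xi> y) \<le> norm (case p of (\<xi>, y) \<Rightarrow> ?B \<xi> y)"
      using bound[of "fst p" "snd p"] unfolding case_prod_beta real_norm_def by linarith
  qed
  have w0: "integrable lborel w"
  proof (rule Bochner_Integration.integrable_bound[OF w])
    show "AE \<xi> in lborel. norm (w \<xi>) \<le> norm ((1 + (norm \<xi>)\<^sup>2) * cmod (w \<xi>))"
      by (intro AE_I2) (simp add: abs_mult mult_le_cancel_right1)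
  qed simp
  have iw: "integrable lborel (\<lambda>\<xi>. w \<xi> * cis (\<xi> \<bullet> u))" for u
    by (rule Bochner_Integration.integrable_bound[OF w0]) (auto simp: norm_mult)
  have inner: "(\<integral>\<xi>. ?H \<xi> y \<partial>lborel) = (\<integral>\<xi>. w \<xi> * cis (\<xi> \<bullet> y) \<partial>lborel)" for y
  proof -
    have gi: "integrable lborel (\<lambda>\<xi>. w \<xi> * (\<i> * of_real (\<xi> \<bullet> y)))"
      and g0: "(\<integral>\<xi>. w \<xi> * (\<i> * of_real (\<xi> \<bullet> y)) \<partial>lborel) = 0"
      by (rule gradient_zero[OF _ w \<eta> zero]; simp)+
    have "?H \<xi> y = (w \<xi> * cis (\<xi> \<bullet> y) - w \<xi> * cis (\<xi> \<bullet> 0)) - of_real (chi y) * (w \<xi> * (\<i> * of_real (\<xi> \<bullet> y)))" for \<xi>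
      by (simp add: levy_integrand_def algebra_simps)
    then have "(\<integral>\<xi>. ?H \<xi> y \<partial>lborel)
        = ((\<integral>\<xi>. w \<xi> * cis (\<xi> \<bullet> y) \<partial>lborel) - (\<integral>\<xi>. w \<xi> * cis (\<xi> \<bullet> 0) \<partial>lborel))
          - of_real (chi y) * (\<integral>\<xi>. w \<xi> * (\<i> * of_real (\<xi> \<bullet> y)) \<partial>lborel)"
      using iw gi
      by (simp only: Bochner_Integration.integral_diff Bochner_Integration.integrable_diff
          integrable_mult_right integral_mult_right_zero)
    moreover have "(\<integral>\<xi>. w \<xi> * cis (\<xi> \<bullet> 0) \<partial>lborel) = 0"
      using zero[of 0] \<eta> by simp
    ultimately show ?thesis using g0 by simp
  qed
  show "integrable N (\<lambda>y. \<integral>\<xi>. w \<xi> * cis (\<xi> \<bullet> y) \<partial>lborel)"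
    using L.integrable_snd[OF H] unfolding inner .
  have drift_int: "integrable lborel (\<lambda>\<xi>. w \<xi> * (\<i> * of_real (\<xi> \<bullet> b)))"
    and drift: "(\<integral>\<xi>. w \<xi> * (\<i> * of_real (\<xi> \<bullet> b)) \<partial>lborel) = 0"
    by (rule gradient_zero[OF _ w \<eta> zero]; simp)+
  have jump_int: "integrable lborel (\<lambda>\<xi>. \<integral>y. ?H \<xi> y \<partial>N)"
    by (rule L.integrable_fst[OF H])
  have "w \<xi> * levy_khintchine b 0 N \<xi> = w \<xi> * (\<i> * of_real (\<xi> \<bullet> b)) + (\<integral>y. ?H \<xi> y \<partial>N)" for \<xi>
    unfolding levy_khintchine_pure_jump distrib_left
    by (simp only: integral_mult_right_zero inner_commute)
  then have "(\<integral>\<xi>. w \<xi> * levy_khintchine b 0 N \<xi> \<partial>lborel) = (\<integral>\<xi>. (\<integral>y. ?H \<xi> y \<partial>N) \<partial>lborel)"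
    using drift_int jump_int drift by (simp only: Bochner_Integration.integral_add) simp
  also have "\<dots> = (\<integral>y. (\<integral>\<xi>. ?H \<xi> y \<partial>lborel) \<partial>N)"
    by (rule L.Fubini_integral[OF H, symmetric])
  finally show "(\<integral>\<xi>. w \<xi> * levy_khintchine b 0 N \<xi> \<partial>lborel)
      = (\<integral>y. (\<integral>\<xi>. w \<xi> * cis (\<xi> \<bullet> y) \<partial>lborel) \<partial>N)"
    unfolding inner .
qed

text \<open>
  With \<open>I a\<close> the symbol integral regularised by the multiplier and \<open>W a\<close> the mollified \<open>f\<close>, the number
  \<open>I a\<close> is a positive multiple of the integral of \<open>W a (x + y)\<close> over the Levy measure. That integral
  bounds the measure of the ball from above, uniformly in small \<open>a\<close>, while \<open>I a\<close> tends to the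
  unregularised integral, which is zero.
\<close>

lemma levy_measure_null_ball:
  fixes f :: "real^'d \<Rightarrow> real"
  assumes N: "levy_measure N"
    and f: "integrable lborel f" "\<And>u. 0 \<le> f u" "\<And>u. f u \<le> 1"
    and \<delta>: "\<delta> > 0" "\<And>u. dist x u < \<delta> \<Longrightarrow> f u = 0"
    and r: "r > 0" "c0 > 0" "\<And>u. dist z u < 2 * r \<Longrightarrow> c0 \<le> f u"
    and int: "integrable lborel (\<lambda>\<xi>. cis (x \<bullet> \<xi>) * levy_khintchine b 0 N \<xi> * fourier f \<xi>)"
    and zero: "(\<integral>\<xi>. cis (x \<bullet> \<xi>) * levy_khintchine b 0 N \<xi> * fourier f \<xi> \<partial>lborel) = 0"
  shows "emeasure N (ball (z - x) r) = 0"
proof -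
  define c where "c = (2 * pi) powr (- real CARD('d) / 2)"
  have c: "c > 0" by (simp add: c_def)
  define W where "W a v = (\<integral>u. f u * mollifier a (v - u) \<partial>lborel)" for a v
  define g where "g \<xi> = cis (x \<bullet> \<xi>) * levy_khintchine b 0 N \<xi> * fourier f \<xi>" for \<xi>
  define I where "I a = (\<integral>\<xi>. of_real (multiplier a \<xi>) * g \<xi> \<partial>lborel)" for a
  have [measurable]: "f \<in> borel_measurable borel" using f(1) by auto
  have [measurable]: "g \<in> borel_measurable borel" using int unfolding g_def[abs_def] by auto
  have sets: "sets N = sets borel" using N by (simp add: levy_measure_def)
  have [measurable]: "fourier f \<in> borel_measurable borel" by (rule fourier_measurable) simp
  have K: "ennreal (c * (c0 * (2 * pi) ^ DIM(real^'d))) * emeasure N (ball (z - x) r) \<le> ennreal (Re (I a))"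
    if a: "a > 0" and a_small: "4 * a * DIM(real^'d) < min (\<delta> / 2) r" for a :: real
  proof -
    let ?w = "\<lambda>\<xi>. cis (x \<bullet> \<xi>) * of_real (multiplier a \<xi>) * fourier f \<xi>"
    have \<Phi>: "(\<integral>\<xi>. ?w \<xi> * cis (\<xi> \<bullet> y) \<partial>lborel) = of_real (c * W a (x + y))" for y
    proof -
      have "?w \<xi> * cis (\<xi> \<bullet> y) = cis ((x + y) \<bullet> \<xi>) * of_real (multiplier a \<xi>) * fourier f \<xi>" for \<xi>
      proof -
        have "cis ((x + y) \<bullet> \<xi>) = cis (x \<bullet> \<xi>) * cis (\<xi> \<bullet> y)"
          by (simp add: cis_mult inner_add_left inner_commute[of \<xi> y])
        then show ?thesis by (simp only: mult_ac)
      qed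
      then show ?thesis
        using mollified_fourier_inversion[OF a f(1), of "x + y"] by (simp only: c_def W_def)
    qed
    have W0: "W a (x + y) = 0" if y: "norm y < \<delta> / 2" for y
    proof -
      have "f u * mollifier a (x + y - u) = 0" for u
      proof (cases "dist x u < \<delta>")
        case False
        have "dist x u \<le> norm (x + y - u) + norm y"
          using norm_triangle_ineq4[of "x + y - u" y] by (simp add: dist_norm)
        then have "norm (x + y - u) > 4 * a * DIM(real^'d)"
          using False y a_small by simp
        then show ?thesis using mollifier_eq_0[OF a, of "x + y - u"] by simp
      qed (simp add: \<delta>)
      then show ?thesis unfolding W_def by (simp only: Bochner_Integration.integral_zero)
    qed
    have wm: "?w \<in> borel_measurable borel" by measurable
    have z0: "(\<integral>\<xi>. ?w \<xi> * cis (\<xi> \<bullet> v) \<partial>lborel) = 0" if "norm v < \<delta> / 2" for v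
      unfolding \<Phi> using W0[OF that] by simp
    note fub = levy_khintchine_fubini[OF N wm mollified_fourier_integrable[OF a f(1)] half_gt_zero[OF \<delta>(1)] z0, unfolded \<Phi>]
    have "I a = (\<integral>\<xi>. ?w \<xi> * levy_khintchine b 0 N \<xi> \<partial>lborel)"
      unfolding I_def g_def by (simp only: mult_ac)
    also have "\<dots> = (\<integral>y. of_real (c * W a (x + y)) \<partial>N)"
      by (rule fub(2))
    finally have I: "Re (I a) = (\<integral>y. c * W a (x + y) \<partial>N)"
      by (simp only: integral_complex_of_real Re_complex_of_real)
    have intW: "integrable N (\<lambda>y. c * W a (x + y))"
      using integrable_Re[OF fub(1)] by (simp only: Re_complex_of_real)
    have W_nonneg: "0 \<le> W a v" for v
      unfolding W_def by (intro integral_nonneg_AE AE_I2 mult_nonneg_nonneg f mollifier_nonneg[OF a])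
    have W_ge: "c0 * (2 * pi) ^ DIM(real^'d) \<le> W a v" if v: "dist z v < r" for v
    proof -
      have moll: "integrable lborel (\<lambda>u. mollifier a (v - u))"
        and moll_int: "(\<integral>u. mollifier a (v - u) \<partial>lborel) = (2 * pi) ^ DIM(real^'d)"
        using mollifier_integral[OF a, of v] by (auto simp: has_bochner_integral_iff)
      have fm: "integrable lborel (\<lambda>u. f u * mollifier a (v - u))"
      proof (rule Bochner_Integration.integrable_bound[OF moll])
        show "(\<lambda>u. f u * mollifier a (v - u)) \<in> borel_measurable lborel"
          using moll by (intro borel_measurable_times) auto
        show "AE u in lborel. norm (f u * mollifier a (v - u)) \<le> norm (mollifier a (v - u))"
          using f by (intro AE_I2) (simp add: abs_mult mult_left_le_one_le)
      qed
      have "c0 * (2 * pi) ^ DIM(real^'d) = (\<integral>u. c0 * mollifier a (v - u) \<partial>lborel)"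
        by (simp only: moll_int integral_mult_right_zero)
      also have "\<dots> \<le> W a v"
        unfolding W_def
      proof (rule integral_mono[OF integrable_mult_right[OF moll] fm])
        fix u
        show "c0 * mollifier a (v - u) \<le> f u * mollifier a (v - u)"
        proof (cases "norm (v - u) > 4 * a * DIM(real^'d)")
          case True
          then show ?thesis using mollifier_eq_0[OF a, of "v - u"] by simp
        next
          case False
          have "dist z u \<le> dist z v + norm (v - u)"
            by (metis dist_norm dist_triangle)
          then have "dist z u < 2 * r" using False v a_small by simp
          then show ?thesis by (intro mult_right_mono r mollifier_nonneg[OF a])
        qed
      qed
      finally show ?thesis .
    qed
    have "ennreal (c * (c0 * (2 * pi) ^ DIM(real^'d))) * emeasure N (ball (z - x) r)
        = (\<integral>\<^sup>+y. ennreal (c * (c0 * (2 * pi) ^ DIM(real^'d))) * indicator (ball (z - x) r) y \<partial>N)"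
      by (simp add: nn_integral_cmult_indicator sets)
    also have "\<dots> \<le> (\<integral>\<^sup>+y. ennreal (c * W a (x + y)) \<partial>N)"
    proof (rule nn_integral_mono)
      fix y
      have "dist z (x + y) = dist (z - x) y" by (simp add: dist_norm algebra_simps)
      then show "ennreal (c * (c0 * (2 * pi) ^ DIM(real^'d))) * indicator (ball (z - x) r) y
          \<le> ennreal (c * W a (x + y))"
        using W_ge[of "x + y"] c
        by (auto simp: indicator_def intro!: ennreal_leI mult_left_mono)
    qed
    also have "\<dots> = ennreal (Re (I a))"
      unfolding I using c W_nonneg by (intro nn_integral_eq_integral intW) auto
    finally show ?thesis .
  qed
  \<comment> \<open>Keeps the support of the mollifier within both radii \<open>\<delta> / 2\<close> and \<open>r\<close>, with a factor two to spare for strictness.\<close>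
  define a0 where "a0 = min (\<delta> / 2) r / (8 * DIM(real^'d))"
  define s where "s n = a0 * inverse (real (Suc n))" for n
  have a0: "a0 > 0" unfolding a0_def using \<delta> r by simp
  have s: "s n > 0" "s n \<le> a0" for n
    unfolding s_def using a0 by (auto simp: mult_le_cancel_left1 inverse_le_1_iff)
  have "s \<longlonglongrightarrow> a0 * 0"
    unfolding s_def[abs_def] by (intro tendsto_mult tendsto_const LIMSEQ_inverse_real_of_nat)
  then have s_lim: "filterlim s (at_right 0) sequentially"
    using s(1) by (intro tendsto_imp_filterlim_at_right) auto
  have "(\<lambda>n. I (s n)) \<longlonglongrightarrow> (\<integral>\<xi>. g \<xi> \<partial>lborel)"
    unfolding I_def
  proof (rule integral_dominated_convergence)
    show "integrable lborel (\<lambda>\<xi>. norm (g \<xi>))" using int unfolding g_def by (rule integrable_norm)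
    show "AE \<xi> in lborel. (\<lambda>n. of_real (multiplier (s n) \<xi>) * g \<xi>) \<longlonglongrightarrow> g \<xi>"
    proof (rule AE_I2)
      fix \<xi>
      have "(\<lambda>n. of_real (multiplier (s n) \<xi>) * g \<xi>) \<longlonglongrightarrow> of_real 1 * g \<xi>"
        by (intro tendsto_mult tendsto_of_real tendsto_const filterlim_compose[OF multiplier_tendsto s_lim])
      then show "(\<lambda>n. of_real (multiplier (s n) \<xi>) * g \<xi>) \<longlonglongrightarrow> g \<xi>" by simp
    qed
    show "AE \<xi> in lborel. norm (of_real (multiplier (s n) \<xi>) * g \<xi>) \<le> norm (g \<xi>)" for n
      by (intro AE_I2) (simp add: norm_mult multiplier_nonneg multiplier_le_1 mult_left_le_one_le)
  qed measurable
  then have "(\<lambda>n. ennreal (Re (I (s n)))) \<longlonglongrightarrow> ennreal (Re 0)"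
    using zero unfolding g_def by (intro tendsto_ennrealI tendsto_Re) simp
  moreover have "ennreal (c * (c0 * (2 * pi) ^ DIM(real^'d))) * emeasure N (ball (z - x) r)
      \<le> ennreal (Re (I (s n)))" for n
  proof (rule K[OF s(1)])
    have "4 * s n * DIM(real^'d) \<le> 4 * a0 * DIM(real^'d)"
      using s(2)[of n] by (intro mult_right_mono) auto
    also have "\<dots> = min (\<delta> / 2) r / 2" by (simp add: a0_def)
    also have "\<dots> < min (\<delta> / 2) r" using \<delta>(1) r(1) by linarith
    finally show "4 * s n * DIM(real^'d) < min (\<delta> / 2) r" .
  qed
  ultimately have "ennreal (c * (c0 * (2 * pi) ^ DIM(real^'d))) * emeasure N (ball (z - x) r) \<le> ennreal (Re 0)"
    by (intro LIMSEQ_le_const) auto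
  then show ?thesis using c r by simp
qed

section \<open>Small-time asymptotics under positive upper orthant dependence\<close>

lemma C0_bounded:
  fixes f :: "'a::euclidean_space \<Rightarrow> real"
  assumes "f \<in> C0" shows "bounded (range f)"
proof -
  have "\<forall>\<^sub>F x in at_infinity. dist (f x) 0 < 1"
    using assms tendstoD[of f 0 at_infinity 1] by (simp add: C0_def)
  then obtain R where R: "\<And>x. R \<le> norm x \<Longrightarrow> \<bar>f x\<bar> < 1"
    unfolding eventually_at_infinity by (auto simp: dist_real_def)
  have "compact (f ` cball 0 R)"
    using assms by (intro compact_continuous_image) (auto simp: C0_def intro: continuous_on_subset)
  then have "bounded (f ` cball 0 R \<union> ball 0 1)" by (simp add: compact_imp_bounded)
  moreover have "range f \<subseteq> f ` cball 0 R \<union> ball 0 1"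
    using R by (force simp: not_le intro: less_imp_le)
  ultimately show ?thesis by (rule bounded_subset)
qed

lemma abs_le_sup_norm: "bounded (range f) \<Longrightarrow> \<bar>f x\<bar> \<le> sup_norm f"
  unfolding sup_norm_def
  by (rule cSUP_upper) (auto simp: bounded_iff bdd_above_def)

text \<open>
  The supremum norm controls the values only for bounded functions, since it is an unconstrained
  real supremum; hence the appeal to boundedness of the functions in \<open>C0\<close>.
\<close>

lemma right_generator_pointwise:
  assumes T: "feller_evolution_system T" and s: "0 \<le> s" and fg: "(f, g) \<in> right_generator T s"
  shows "((\<lambda>h. (T s (s + h) f x - f x) / h) \<longlongrightarrow> g x) (at_right 0)"
proof -
  have f: "bounded (range f)" and g: "bounded (range g)"
    using fg C0_bounded by (auto simp: right_generator_def)
  have lim: "((\<lambda>h. sup_norm (\<lambda>x. (T s (s + h) f x - f x) / h - g x)) \<longlongrightarrow> 0) (at_right 0)"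
    using fg by (simp add: right_generator_def)
  have "\<bar>(T s (s + h) f x - f x) / h - g x\<bar> \<le> sup_norm (\<lambda>x. (T s (s + h) f x - f x) / h - g x)"
    if h: "0 < h" for h
  proof (rule abs_le_sup_norm)
    have "T s (s + h) f \<in> C0"
      using T s h fg by (auto simp: feller_evolution_system_def right_generator_def)
    then have "bounded (range (T s (s + h) f))" by (rule C0_bounded)
    from bounded_minus_comp[OF bounded_scaleR_comp[OF bounded_minus_comp[OF this f], of "1 / h"] g]
    show "bounded (range (\<lambda>x. (T s (s + h) f x - f x) / h - g x))" by simp
  qed
  then have "\<forall>\<^sub>F h in at_right 0. norm ((T s (s + h) f x - f x) / h - g x)
      \<le> sup_norm (\<lambda>x. (T s (s + h) f x - f x) / h - g x)"
    unfolding eventually_at_right_field by (auto intro: exI[of _ 1])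
  from Lim_null_comparison[OF this lim] show ?thesis
    by (rule Lim_null[THEN iffD2])
qed

text \<open>
  Positive upper orthant dependence gives \<open>P(A) P(B) \<le> P(A \<inter> B)\<close> for the upper tail events \<open>A\<close> in
  coordinate \<open>i\<close> and \<open>B\<close> in coordinate \<open>j\<close>. Subtracting from \<open>P(A)\<close> reverses the inequality for the
  complement of \<open>B\<close>.
\<close>

lemma PUOD_opposite_tails:
  assumes PUOD: "spatially_PUOD P X" and st: "0 \<le> s" "s \<le> t"
    and prob: "prob_space (P s x)" and X [measurable]: "X t \<in> borel_measurable (P s x)"
    and ij: "i \<noteq> j"
  shows "measure (P s x) {\<omega> \<in> space (P s x). \<alpha> < X t \<omega> $ i \<and> X t \<omega> $ j \<le> \<beta>}
    \<le> measure (P s x) {\<omega> \<in> space (P s x). \<alpha> < X t \<omega> $ i}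
      * measure (P s x) {\<omega> \<in> space (P s x). X t \<omega> $ j \<le> \<beta>}"
proof -
  interpret prob_space "P s x" by fact
  let ?Q = "P s x"
  define A where "A = {\<omega> \<in> space ?Q. \<alpha> < X t \<omega> $ i}"
  define B where "B = {\<omega> \<in> space ?Q. \<beta> < X t \<omega> $ j}"
  have [measurable]: "(\<lambda>\<omega>. X t \<omega> $ k) \<in> borel_measurable ?Q" for k
    by (rule measurable_compose[OF X]) (simp add: borel_measurable_continuous_onI continuous_on_component)
  have AB [measurable]: "A \<in> events" "B \<in> events" unfolding A_def B_def by measurable
  \<comment> \<open>With open half-lines the indicators are nondecreasing, and the complement in coordinate \<open>j\<close> is a closed lower tail.\<close>
  define f where "f k y = (if k = i then indicator {\<alpha><..} y else if k = j then indicator {\<beta><..} y else 1 :: real)"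
    for k y
  have "mono (f k)" "\<forall>y. 0 \<le> f k y" for k
    by (auto simp: f_def mono_def indicator_def)
  then have puod: "(\<Prod>k\<in>UNIV. \<integral>\<^sup>+\<omega>. ennreal (f k (X t \<omega> $ k)) \<partial>?Q)
      \<le> (\<integral>\<^sup>+\<omega>. ennreal (\<Prod>k\<in>UNIV. f k (X t \<omega> $ k)) \<partial>?Q)"
    using PUOD st by (simp add: spatially_PUOD_def)
  have pair: "(\<Prod>k\<in>UNIV. h k) = h i * h j" if "\<And>k. k \<noteq> i \<Longrightarrow> k \<noteq> j \<Longrightarrow> h k = 1"
    for h :: "_ \<Rightarrow> 'c::comm_monoid_mult"
  proof -
    have "(\<Prod>k\<in>UNIV. h k) = (\<Prod>k\<in>{i, j}. h k)"
      using that by (intro prod.mono_neutral_right) auto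
    then show ?thesis using ij by simp
  qed
  have "(\<Prod>k\<in>UNIV. \<integral>\<^sup>+\<omega>. ennreal (f k (X t \<omega> $ k)) \<partial>?Q)
      = (\<integral>\<^sup>+\<omega>. ennreal (f i (X t \<omega> $ i)) \<partial>?Q) * (\<integral>\<^sup>+\<omega>. ennreal (f j (X t \<omega> $ j)) \<partial>?Q)"
    by (rule pair) (simp add: f_def emeasure_space_1)
  also have "(\<integral>\<^sup>+\<omega>. ennreal (f i (X t \<omega> $ i)) \<partial>?Q) = (\<integral>\<^sup>+\<omega>. indicator A \<omega> \<partial>?Q)"
    by (intro nn_integral_cong) (auto simp: f_def A_def indicator_def)
  also have "(\<integral>\<^sup>+\<omega>. ennreal (f j (X t \<omega> $ j)) \<partial>?Q) = (\<integral>\<^sup>+\<omega>. indicator B \<omega> \<partial>?Q)"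
    using ij by (intro nn_integral_cong) (auto simp: f_def B_def indicator_def)
  finally have lhs: "(\<Prod>k\<in>UNIV. \<integral>\<^sup>+\<omega>. ennreal (f k (X t \<omega> $ k)) \<partial>?Q) = ennreal (prob A * prob B)"
    by (simp add: AB emeasure_eq_measure ennreal_mult)
  have "(\<integral>\<^sup>+\<omega>. ennreal (\<Prod>k\<in>UNIV. f k (X t \<omega> $ k)) \<partial>?Q) = (\<integral>\<^sup>+\<omega>. indicator (A \<inter> B) \<omega> \<partial>?Q)"
  proof (intro nn_integral_cong)
    fix \<omega> assume "\<omega> \<in> space ?Q"
    have "(\<Prod>k\<in>UNIV. f k (X t \<omega> $ k)) = f i (X t \<omega> $ i) * f j (X t \<omega> $ j)"
      by (rule pair) (simp add: f_def)
    with \<open>\<omega> \<in> space ?Q\<close> ij show "ennreal (\<Prod>k\<in>UNIV. f k (X t \<omega> $ k)) = indicator (A \<inter> B) \<omega>"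
      by (auto simp: f_def A_def B_def indicator_def)
  qed
  then have rhs: "(\<integral>\<^sup>+\<omega>. ennreal (\<Prod>k\<in>UNIV. f k (X t \<omega> $ k)) \<partial>?Q) = ennreal (prob (A \<inter> B))"
    by (simp add: AB emeasure_eq_measure)
  from puod have le: "prob A * prob B \<le> prob (A \<inter> B)"
    unfolding lhs rhs by simp
  have "{\<omega> \<in> space ?Q. \<alpha> < X t \<omega> $ i \<and> X t \<omega> $ j \<le> \<beta>} = A - A \<inter> B"
    "{\<omega> \<in> space ?Q. X t \<omega> $ j \<le> \<beta>} = space ?Q - B"
    unfolding A_def B_def by auto
  then have e1: "measure ?Q {\<omega> \<in> space ?Q. \<alpha> < X t \<omega> $ i \<and> X t \<omega> $ j \<le> \<beta>} = prob A - prob (A \<inter> B)"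
    and e2: "measure ?Q {\<omega> \<in> space ?Q. X t \<omega> $ j \<le> \<beta>} = 1 - prob B"
    using AB by (simp_all add: finite_measure_Diff prob_compl)
  show ?thesis
    unfolding e1 e2 A_def[symmetric] using le by (simp add: right_diff_distrib)
qed

text \<open>
  The bump \<open>f\<close> at \<open>x\<close> satisfies \<open>f(x) = 1\<close>, hence \<open>1 - E f(X)\<close> is \<open>O(h)\<close>, and it bounds the
  probability of leaving the \<open>\<epsilon>\<close>-ball around \<open>x\<close>. Both one-coordinate tails are contained in that
  event, so the joint opposite tail, which contains the support of the bump at \<open>z\<close>, has
  probability \<open>O(h\<^sup>2)\<close>.
\<close>

lemma PUOD_generator_zero:
  fixes P :: "real \<Rightarrow> real^'d \<Rightarrow> 'w measure"
  assumes FES: "feller_evolution_system (markov_evolution P X)" and PUOD: "spatially_PUOD P X"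
    and s: "0 \<le> s" and prob: "prob_space (P s x)" and X: "\<And>t. 0 \<le> t \<Longrightarrow> X t \<in> borel_measurable (P s x)"
    and rich: "Cc_infty \<subseteq> Domain (right_generator (markov_evolution P X) s)"
    and \<epsilon>: "\<epsilon> > 0" and z: "x $ i + 2 * \<epsilon> \<le> z $ i" "z $ j + 2 * \<epsilon> \<le> x $ j"
    and g: "(bump z \<epsilon>, g) \<in> right_generator (markov_evolution P X) s"
  shows "g x = 0"
proof -
  interpret prob_space "P s x" by fact
  have ij: "i \<noteq> j" using z \<epsilon> by auto
  obtain g0 where g0: "(bump x \<epsilon>, g0) \<in> right_generator (markov_evolution P X) s"
    using rich bump_in_Cc_infty[OF \<epsilon>, of x] by blast
  let ?T = "\<lambda>h. markov_evolution P X s (s + h)"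
  define q where "q h = (1 - ?T h (bump x \<epsilon>) x) / h" for h
  have "((\<lambda>h. (?T h (bump x \<epsilon>) x - 1) / h) \<longlongrightarrow> g0 x) (at_right 0)"
    using right_generator_pointwise[OF FES s g0, of x] by (simp add: bump_centre[OF \<epsilon>])
  moreover have "q = (\<lambda>h. - ((?T h (bump x \<epsilon>) x - 1) / h))"
    by (simp add: fun_eq_iff q_def diff_divide_distrib)
  ultimately have q: "(q \<longlongrightarrow> - g0 x) (at_right 0)"
    by (simp only: tendsto_minus)
  have zx: "\<epsilon> \<le> dist z x"
  proof -
    have "\<epsilon> \<le> \<bar>(z - x) $ i\<bar>" using z \<epsilon> by simp
    also have "\<dots> \<le> norm (z - x)" by (rule component_le_norm_cart)
    finally show ?thesis by (simp add: dist_norm)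
  qed
  have lim: "((\<lambda>h. ?T h (bump z \<epsilon>) x / h) \<longlongrightarrow> g x) (at_right 0)"
    using right_generator_pointwise[OF FES s g, of x] by (simp add: bump_eq_0[OF \<epsilon> zx])
  have bounds: "0 \<le> ?T h (bump z \<epsilon>) x / h \<and> ?T h (bump z \<epsilon>) x / h \<le> (q h)\<^sup>2 * h" if h: "0 < h" for h
  proof -
    define Y where "Y = X (s + h)"
    have Y [measurable]: "Y \<in> borel_measurable (P s x)" unfolding Y_def using X s h by simp
    have [measurable]: "(\<lambda>\<omega>. Y \<omega> $ k) \<in> borel_measurable (P s x)" for k
      by (rule measurable_compose[OF Y]) (simp add: borel_measurable_continuous_onI continuous_on_component)
    have [measurable]: "bump c \<epsilon> \<in> borel_measurable borel" for c :: "real^'d"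
      by (rule borel_measurable_continuous_onI[OF bump_continuous[OF \<epsilon>]])
    have int: "integrable (P s x) (\<lambda>\<omega>. bump c \<epsilon> (Y \<omega>))" for c
      by (rule integrable_const_bound[of _ 1]) (use bump_nonneg[of c \<epsilon>] bump_le_1[OF \<epsilon>, of c] in auto)
    have ev: "?T h f x = (\<integral>\<omega>. f (Y \<omega>) \<partial>P s x)" for f
      by (simp add: markov_evolution_def Y_def)
    define E where "E = 1 - ?T h (bump x \<epsilon>) x"
    have tail: "prob {\<omega> \<in> space (P s x). R (Y \<omega>)} \<le> E"
      if R: "{\<omega> \<in> space (P s x). R (Y \<omega>)} \<in> events" "\<And>u. R u \<Longrightarrow> \<epsilon> \<le> dist x u" for R
    proof -
      have "prob {\<omega> \<in> space (P s x). R (Y \<omega>)} = (\<integral>\<omega>. indicator {\<omega> \<in> space (P s x). R (Y \<omega>)} \<omega> \<partial>P s x)"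
        using R(1) by simp
      also have "\<dots> \<le> (\<integral>\<omega>. 1 - bump x \<epsilon> (Y \<omega>) \<partial>P s x)"
      proof (rule integral_mono)
        show "integrable (P s x) (indicator {\<omega> \<in> space (P s x). R (Y \<omega>)} :: _ \<Rightarrow> real)"
          using R(1) by (simp add: less_top[symmetric])
        show "integrable (P s x) (\<lambda>\<omega>. 1 - bump x \<epsilon> (Y \<omega>))" using int by simp
        show "indicator {\<omega> \<in> space (P s x). R (Y \<omega>)} \<omega> \<le> 1 - bump x \<epsilon> (Y \<omega>)" for \<omega>
          using bump_eq_0[OF \<epsilon> R(2)] bump_le_1[OF \<epsilon>, of x "Y \<omega>"] by (auto simp: indicator_def)
      qed
      also have "\<dots> = E"
        using int by (simp add: E_def ev prob_space)
      finally show ?thesis .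
    qed
    let ?U = "{\<omega> \<in> space (P s x). x $ i + \<epsilon> < Y \<omega> $ i}"
    let ?V = "{\<omega> \<in> space (P s x). Y \<omega> $ j \<le> x $ j - \<epsilon>}"
    let ?UV = "{\<omega> \<in> space (P s x). x $ i + \<epsilon> < Y \<omega> $ i \<and> Y \<omega> $ j \<le> x $ j - \<epsilon>}"
    have dist_ge: "\<bar>x $ k - u $ k\<bar> \<le> dist x u" for u k
      using component_le_norm_cart[of "x - u" k] by (simp add: dist_norm)
    have U: "prob ?U \<le> E"
    proof (rule tail)
      show "\<epsilon> \<le> dist x u" if "x $ i + \<epsilon> < u $ i" for u using dist_ge[of i u] that by linarith
    qed measurable
    have V: "prob ?V \<le> E"
    proof (rule tail)
      show "\<epsilon> \<le> dist x u" if "u $ j \<le> x $ j - \<epsilon>" for u using dist_ge[of j u] that by linarith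
    qed measurable
    have "?T h (bump z \<epsilon>) x \<le> prob ?UV"
    proof -
      have UV: "?UV \<in> events" by measurable
      have "?T h (bump z \<epsilon>) x \<le> (\<integral>\<omega>. indicator ?UV \<omega> \<partial>P s x)"
        unfolding ev
      proof (rule integral_mono[OF int])
        show "integrable (P s x) (indicator ?UV :: _ \<Rightarrow> real)"
          using UV by (simp add: less_top[symmetric])
        fix \<omega> assume \<omega>: "\<omega> \<in> space (P s x)"
        show "bump z \<epsilon> (Y \<omega>) \<le> indicator ?UV \<omega>"
        proof (cases "\<epsilon> \<le> dist z (Y \<omega>)")
          case True
          then show ?thesis by (simp add: bump_eq_0[OF \<epsilon>])
        next
          case False
          have "\<bar>z $ k - Y \<omega> $ k\<bar> < \<epsilon>" for k
            using component_le_norm_cart[of "z - Y \<omega>" k] False by (simp add: dist_norm)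
          from this[of i] this[of j] have "\<omega> \<in> ?UV" using \<omega> z by auto
          then show ?thesis using bump_le_1[OF \<epsilon>, of z] by simp
        qed
      qed
      also have "\<dots> = prob ?UV" using UV by simp
      finally show ?thesis .
    qed
    also have "\<dots> \<le> prob ?U * prob ?V"
      using PUOD_opposite_tails[OF PUOD s _ prob X ij, of "s + h" "x $ i + \<epsilon>" "x $ j - \<epsilon>"] s h
      by (simp add: Y_def)
    also have "\<dots> \<le> E * E"
      using U V by (intro mult_mono) (auto intro: order_trans[OF measure_nonneg U])
    finally have "?T h (bump z \<epsilon>) x / h \<le> E * E / h"
      using h by (simp add: divide_right_mono)
    also have "\<dots> = (q h)\<^sup>2 * h"
      using h by (simp add: q_def E_def power2_eq_square)
    finally have "?T h (bump z \<epsilon>) x / h \<le> (q h)\<^sup>2 * h" .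
    moreover have "0 \<le> ?T h (bump z \<epsilon>) x"
      unfolding ev by (intro integral_nonneg_AE AE_I2 bump_nonneg)
    ultimately show ?thesis using h by simp
  qed
  have "((\<lambda>h. (q h)\<^sup>2 * h) \<longlongrightarrow> (- g0 x)\<^sup>2 * 0) (at_right 0)"
    by (intro tendsto_mult tendsto_power q tendsto_ident_at)
  then have up: "((\<lambda>h. (q h)\<^sup>2 * h) \<longlongrightarrow> 0) (at_right 0)" by simp
  have "((\<lambda>h. ?T h (bump z \<epsilon>) x / h) \<longlongrightarrow> 0) (at_right 0)"
    by (rule tendsto_sandwich[OF _ _ tendsto_const up])
      (use bounds in \<open>auto simp: eventually_at_right_field intro: exI[of _ 1]\<close>)
  with lim show "g x = 0"
    by (rule tendsto_unique[OF trivial_limit_at_right_real])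
qed

section \<open>The support of the jump measures\<close>

theorem theorem3p3:
  fixes M :: "'w measure"
    and P :: "real \<Rightarrow> real^'d \<Rightarrow> 'w measure"
    and X :: "real \<Rightarrow> 'w \<Rightarrow> real^'d"
    and T :: "real \<Rightarrow> real \<Rightarrow> (real^'d \<Rightarrow> real) \<Rightarrow> real^'d \<Rightarrow> real"
    and p p_left :: "real \<Rightarrow> real^'d \<Rightarrow> real^'d \<Rightarrow> complex"
    and b :: "real \<Rightarrow> real^'d \<Rightarrow> real^'d"
    and \<nu> :: "real \<Rightarrow> real^'d \<Rightarrow> (real^'d) measure"
  assumes T: "T = markov_evolution P X"
    and FEP: "feller_evolution_process M P X"
    and rich_right: "\<And>s. 0 \<le> s \<Longrightarrow> Cc_infty \<subseteq> Domain (right_generator T s)"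
    and rich_left: "\<And>s. 0 < s \<Longrightarrow> Cc_infty \<subseteq> Domain (left_generator T s)"
    and core: "\<And>s. 0 \<le> s \<Longrightarrow> is_core Cc_infty (right_generator T s)"
    and symbol_right: "\<And>s. 0 \<le> s \<Longrightarrow> has_symbol (right_generator T s) (p s)"
    and symbol_left: "\<And>s. 0 < s \<Longrightarrow> has_symbol (left_generator T s) (p_left s)"
    and continuous_right: "s_continuous {0..} p"
    and continuous_left: "s_continuous {0<..} p_left"
    and bounded_right: "bounded_symbols {0..} p"
    and bounded_left: "bounded_symbols {0<..} p_left"
    and triplet: "\<And>s. 0 \<le> s \<Longrightarrow> characteristic_triplet (p s) (b s) (\<lambda>x. 0) (\<nu> s)"
    and PUOD: "spatially_PUOD P X"
  shows "\<forall>s\<ge>0. \<forall>x. emeasure (\<nu> s x) (- (nonneg_orthant \<union> nonpos_orthant)) = 0"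
proof (intro allI impI)
  fix s :: real and x :: "real^'d"
  assume s: "0 \<le> s"
  have FES: "feller_evolution_system (markov_evolution P X)" and MP: "markov_process M P X"
    using FEP by (simp_all add: feller_evolution_process_def)
  have N: "levy_measure (\<nu> s x)"
    and p: "p s x = levy_khintchine (b s x) 0 (\<nu> s x)"
    using triplet[OF s] by (auto simp: characteristic_triplet_def)
  have sets: "sets (\<nu> s x) = sets borel" using N by (simp add: levy_measure_def)
  have "P s \<in> borel \<rightarrow>\<^sub>M prob_algebra M"
    using MP s by (simp add: markov_process_def)
  then have "P s x \<in> space (prob_algebra M)" by (rule measurable_space) simp
  then have prob: "prob_space (P s x)" and sets_P: "sets (P s x) = sets M"
    by (auto simp: space_prob_algebra)
  have X: "X t \<in> borel_measurable (P s x)" if "0 \<le> t" for t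
    unfolding measurable_cong_sets[OF sets_P refl] using MP that by (simp add: markov_process_def)
  let ?O = "- (nonneg_orthant \<union> nonpos_orthant) :: (real^'d) set"
  have cover: "\<exists>r>0. emeasure (\<nu> s x) (ball y r) = 0" if y: "y \<in> ?O" for y
  proof -
    obtain i j where ij: "0 < y $ i" "y $ j < 0"
      using y by (auto simp: nonneg_orthant_def nonpos_orthant_def not_le)
    define \<epsilon> where "\<epsilon> = min (y $ i) (- y $ j) / 2"
    have \<epsilon>: "\<epsilon> > 0" using ij by (simp add: \<epsilon>_def)
    let ?f = "bump (x + y) \<epsilon>"
    have zi: "x $ i + 2 * \<epsilon> \<le> (x + y) $ i" "(x + y) $ j + 2 * \<epsilon> \<le> x $ j"
      by (auto simp: \<epsilon>_def)
    obtain g where g: "(?f, g) \<in> right_generator (markov_evolution P X) s"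
      using rich_right[OF s] bump_in_Cc_infty[OF \<epsilon>, of "x + y"] unfolding T by blast
    have gx: "g x = 0"
      using PUOD_generator_zero[OF FES PUOD s prob X _ \<epsilon> zi g] rich_right[OF s] unfolding T by blast
    have "integrable lborel (\<lambda>\<xi>. cis (x \<bullet> \<xi>) * p s x \<xi> * fourier ?f \<xi>)"
      and "complex_of_real (g x) = (2 * pi) powr (- real CARD('d) / 2) *\<^sub>R
            (\<integral>\<xi>. cis (x \<bullet> \<xi>) * p s x \<xi> * fourier ?f \<xi> \<partial>lborel)"
      using symbol_right[OF s] g bump_in_Cc_infty[OF \<epsilon>, of "x + y"]
      unfolding has_symbol_def T by blast+
    then have int: "integrable lborel (\<lambda>\<xi>. cis (x \<bullet> \<xi>) * levy_khintchine (b s x) 0 (\<nu> s x) \<xi> * fourier ?f \<xi>)"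
      and zero: "(\<integral>\<xi>. cis (x \<bullet> \<xi>) * levy_khintchine (b s x) 0 (\<nu> s x) \<xi> * fourier ?f \<xi> \<partial>lborel) = 0"
      using gx by (simp_all add: p)
    obtain r where r: "r > 0" "\<And>u. dist (x + y) u < 2 * r \<Longrightarrow> 1 / 2 \<le> ?f u"
      using bump_pos_near_centre[OF \<epsilon>, of "x + y"] by blast
    have away: "?f u = 0" if "dist x u < \<epsilon>" for u
    proof (rule bump_eq_0[OF \<epsilon>])
      have "2 * \<epsilon> \<le> \<bar>y $ i\<bar>" by (simp add: \<epsilon>_def)
      also have "\<dots> \<le> norm y" by (rule component_le_norm_cart)
      also have "\<dots> = dist (x + y) x" by (simp add: dist_norm)
      also have "\<dots> \<le> dist (x + y) u + dist x u" by (metis dist_commute dist_triangle)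
      finally show "\<epsilon> \<le> dist (x + y) u" using that by simp
    qed
    have "emeasure (\<nu> s x) (ball (x + y - x) r) = 0"
      by (rule levy_measure_null_ball[OF N bump_integrable[OF \<epsilon>] bump_nonneg bump_le_1[OF \<epsilon>] \<epsilon> away r(1) _ r(2) int zero])
        auto
    with r(1) show ?thesis by auto
  qed
  let ?F = "{ball y r |y r. emeasure (\<nu> s x) (ball y r) = 0}"
  obtain F where F: "F \<subseteq> ?F" "countable F" "\<Union>F = \<Union>?F"
    using Lindelof[of ?F] by auto
  have "?O \<subseteq> \<Union>?F" using cover by force
  moreover have "\<Union>F \<in> null_sets (\<nu> s x)"
  proof (rule null_sets_UN'[where N = id, simplified])
    show "countable F" by fact
    show "B \<in> null_sets (\<nu> s x)" if "B \<in> F" for B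
      using that F(1) by (auto simp: null_sets_def sets)
  qed
  ultimately have "emeasure (\<nu> s x) ?O \<le> 0"
    using F(3) by (metis emeasure_mono null_setsD1 null_setsD2)
  then show "emeasure (\<nu> s x) ?O = 0" by simp
qed

end
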